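(* Let $$L(z)=\sum_{j\ge0}\frac{z^{2^j}}{\prod_{i=0}^{j-1}(1-z^{2^i})},\qquad M(z)=\sum_{j\ge0}\frac{(-1)^jz^{2^j}}{\prod_{i=0}^{j-1}(1-z^{2^i})}.$$ For all integers $b\ge2$, both $L(1/b)$ and $M(1/b)$ are transcendental and their irrationality exponents are equal to $2$.
   Context: The irrationality exponent $\mu(\xi)$ of an irrational real number $\xi$ is the supremum of the real numbers $\mu$ such that $|\xi-p/q|<q^{-\mu}$ has infinitely many solutions in rational numbers $p/q$. *)

theory Defs
  imports Complex_Main "HOL-Computational_Algebra.Polynomial" "HOL-Library.Extended_Real"
begin

definition L_fun :: "real \<Rightarrow> real" where
  "L_fun z = (\<Sum>j. z ^ (2 ^ j) / (\<Prod>i<j. 1 - z ^ (2 ^ i)))"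

definition M_fun :: "real \<Rightarrow> real" where
  "M_fun z = (\<Sum>j. (-1) ^ j * z ^ (2 ^ j) / (\<Prod>i<j. 1 - z ^ (2 ^ i)))"

definition irrationality_exponent :: "real \<Rightarrow> ereal" where
  "irrationality_exponent \<xi> =
     Sup (ereal ` {\<mu>::real. infinite {r::rat.
        \<bar>\<xi> - real_of_rat r\<bar> < real_of_int (snd (quotient_of r)) powr (- \<mu>)}})"

end

theory Submission
  imports Defs "HOL-Analysis.Analysis" "HOL-Library.Z2"
    "HOL-Computational_Algebra.Computational_Algebra" "HOL-Real_Asymp.Real_Asymp"
begin

text \<open>
  The two functions satisfy $f(z) = z + s f(z^2) / (1 - z)$ with $s = 1$ and $s = -1$, respectively.

  Modulo 2, $f$ becomes a quadratic irrationality: $f^2 + (1 + z) f + z (1 + z) = 0$ over the field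
  with two elements. The norm $P^2 + (1 + z) P Q + z (1 + z) Q^2$ of $Q f - P$ is a nonzero
  polynomial of degree at most $2n + 2$ whenever $P$ and $Q$ have degree at most $n$, so a Pade
  approximant of degree $n$ whose denominator $Q$ is primitive over the integers has a remainder of
  order exactly $2n + 1$ or $2n + 2$. Evaluating these approximants at $b^{-2^m}$ and pulling back
  along the functional equation gives, for $N \<le> n \<le> 2N$ and all large $m$, rational approximations
  whose denominators grow at most like $q^{1 + O(1/N)}$ from one to the next, and this forces the
  irrationality exponent to be at most 2.

  Transcendence follows from Mahler's method. On $(0, 1)$ the function grows faster than every power
  of $1/(1 - z)$ as $z$ tends to 1, hence it is not algebraic over the rational functions, and a
  polynomial in $z$ and $f$ that vanishes to high order at 0 contradicts Liouville's inequality
  when it is evaluated at $b^{-2^m}$.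
\<close>

section \<open>Siegel's lemma and Liouville's inequality\<close>

text \<open>Modulo 2 the two signs coincide and \<open>f(z^2)\<close> equals \<open>f(z)^2\<close>,
  which is where the quadratic equation comes from. The resulting control of the remainder holds for
  every degree \<open>n\<close>, and the exponent needs that: raising \<open>m\<close> by one
  squares the denominator bounds, so one fixed degree leaves gaps too wide for exponent 2. The
  degrees from \<open>N\<close> to \<open>2 * N\<close> fill the gap between consecutive levels
  \<open>m\<close>. The remainder is bounded from both sides because a competing fraction may
  coincide with an approximant; then the determinant of the two fractions vanishes, and only the
  lower bound gives a contradiction. Pulling back from \<open>b^(-2^m)\<close> to \<open>1/b\<close>
  costs a single factor \<open>b^(2^m)\<close>, because \<open>1 + 2 + ... + 2^(m-1)\<close> is
  below \<open>2^m\<close>. Against a denominator of size \<open>b^(2^m * n)\<close> with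
  \<open>n\<close> at least \<open>N\<close> this is a relative loss of \<open>1/N\<close> in the
  exponent. For transcendence the decisive point is that the Liouville exponent does not grow with
  the degree of the polynomial: an auxiliary function vanishing to order about \<open>N^2\<close>
  then beats heights that grow only with exponent \<open>2 * N\<close>.\<close>

lemma siegel_lemma:
  fixes m :: "'j \<Rightarrow> 'i \<Rightarrow> int" and H :: nat
  assumes I: "finite I" and J: "finite J" and less: "card J < card I" and H: "H \<ge> 1"
    and m: "\<And>i j. i \<in> I \<Longrightarrow> j \<in> J \<Longrightarrow> \<bar>m j i\<bar> \<le> int H"
  obtains x :: "'i \<Rightarrow> int" where "\<exists>i\<in>I. x i \<noteq> 0"
    "\<And>j. j \<in> J \<Longrightarrow> (\<Sum>i\<in>I. m j i * x i) = 0"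
    "\<And>i. i \<in> I \<Longrightarrow> \<bar>x i\<bar> \<le> int ((card I * H) ^ card J)"
proof -
  define n where "n = card I"
  define r where "r = card J"
  \<comment> \<open>With this side length \<open>(n * H)^r * (W + 1)^r = W * (W + 1)^r\<close>,
    which is below \<open>(W + 1)^(r + 1)\<close>, so the box has more points than the target. The
    exponent \<open>r\<close> is the usual \<open>r / (n - r)\<close> for one unknown more than
    equations, the situation in every application below.\<close>
  define W where "W = (n * H) ^ r"
  define S where "S = (\<Pi>\<^sub>E i\<in>I. {0..int W})"
  \<comment> \<open>On the box with sides from 0 to \<open>W\<close>, the form with index
    \<open>j\<close> ranges between \<open>- neg j * W\<close> and \<open>pos j * W\<close>; the
    length of this interval depends only on the sum of absolute coefficients.\<close>
  define neg where "neg j = (\<Sum>i\<in>I. if m j i < 0 then - m j i else 0)" for j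
  define pos where "pos j = (\<Sum>i\<in>I. if m j i < 0 then 0 else m j i)" for j
  define T where "T = (\<Pi>\<^sub>E j\<in>J. {- neg j * int W..pos j * int W})"
  define \<phi> where "\<phi> x = (\<lambda>j\<in>J. \<Sum>i\<in>I. m j i * x i)" for x :: "'i \<Rightarrow> int"
  have n: "n \<ge> 1" using less by (simp add: n_def)
  have neg_pos: "neg j + pos j \<le> int (n * H)" if "j \<in> J" for j
  proof -
    have "neg j + pos j = (\<Sum>i\<in>I. \<bar>m j i\<bar>)"
      by (auto simp: neg_def pos_def sum.distrib [symmetric] intro!: sum.cong)
    also have "\<dots> \<le> (\<Sum>i\<in>I. int H)" by (intro sum_mono m that)
    finally show ?thesis by (simp add: n_def)
  qed
  have img: "\<phi> ` S \<subseteq> T"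
  proof
    fix y assume "y \<in> \<phi> ` S"
    then obtain x where x: "x \<in> S" and y: "y = \<phi> x" by auto
    have xi: "0 \<le> x i" "x i \<le> int W" if "i \<in> I" for i
      using x that by (auto simp: S_def PiE_iff)
    have "- neg j * int W \<le> (\<Sum>i\<in>I. m j i * x i)" for j
      unfolding neg_def sum_negf [symmetric] sum_distrib_right
    proof (rule sum_mono)
      fix i assume "i \<in> I"
      with xi [of i] show "- (if m j i < 0 then - m j i else 0) * int W \<le> m j i * x i"
        by (auto intro: mult_left_mono_neg)
    qed
    moreover have "(\<Sum>i\<in>I. m j i * x i) \<le> pos j * int W" for j
      unfolding pos_def sum_distrib_right
    proof (rule sum_mono)
      fix i assume "i \<in> I"
      with xi [of i] show "m j i * x i \<le> (if m j i < 0 then 0 else m j i) * int W"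
        by (auto intro: mult_left_mono mult_nonpos_nonneg)
    qed
    ultimately show "y \<in> T" by (auto simp: y T_def \<phi>_def PiE_iff)
  qed
  have "card (\<phi> ` S) \<le> card T"
    using img J by (intro card_mono) (auto simp: T_def intro!: finite_PiE)
  also have "card T = (\<Prod>j\<in>J. nat ((neg j + pos j) * int W + 1))"
    using J by (simp add: T_def card_PiE algebra_simps)
  also have "\<dots> \<le> (\<Prod>j\<in>J. n * H * W + 1)"
  proof (rule prod_mono, safe)
    fix j assume "j \<in> J"
    then have "(neg j + pos j) * int W + 1 \<le> int (n * H) * int W + 1"
      using neg_pos by (simp add: mult_right_mono del: of_nat_mult)
    also have "\<dots> = int (n * H * W + 1)" by simp
    finally show "nat ((neg j + pos j) * int W + 1) \<le> n * H * W + 1" by linarith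
  qed
  also have "\<dots> = (n * H * W + 1) ^ r" by (simp add: r_def)
  also have "\<dots> \<le> (n * H * (W + 1)) ^ r"
    using n H by (intro power_mono) (auto simp: algebra_simps)
  also have "\<dots> = W * (W + 1) ^ r" unfolding W_def by (rule power_mult_distrib)
  also have "\<dots> < (W + 1) ^ Suc r" by simp
  also have "\<dots> \<le> (W + 1) ^ n" using less by (intro power_increasing) (auto simp: n_def r_def)
  also have "\<dots> = card S" using I by (simp add: S_def card_PiE n_def nat_add_distrib)
  finally have "\<not> inj_on \<phi> S" by (auto dest: pigeonhole)
  then obtain x y where xy: "x \<in> S" "y \<in> S" "\<phi> x = \<phi> y" "x \<noteq> y" by (auto simp: inj_on_def)
  show ?thesis
  proof (rule that [of "\<lambda>i. x i - y i"])
    show "\<exists>i\<in>I. x i - y i \<noteq> 0"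
      using xy by (metis PiE_ext S_def eq_iff_diff_eq_0)
    show "(\<Sum>i\<in>I. m j i * (x i - y i)) = 0" if "j \<in> J" for j
      using fun_cong [OF xy(3), of j] that by (simp add: \<phi>_def sum_subtractf right_diff_distrib)
    show "\<bar>x i - y i\<bar> \<le> int ((card I * H) ^ card J)" if "i \<in> I" for i
    proof -
      have "x i \<in> {0..int W}" "y i \<in> {0..int W}" using xy that by (auto simp: S_def PiE_iff)
      then show ?thesis by (simp add: W_def n_def r_def) linarith
    qed
  qed
qed

section \<open>Integer polynomials at an algebraic number\<close>

lemma poly_of_int_altdef:
  fixes x :: real
  assumes "degree p \<le> n"
  shows "poly (map_poly real_of_int p) x = (\<Sum>i\<le>n. real_of_int (coeff p i) * x ^ i)"
proof -
  have "poly (map_poly real_of_int p) x = (\<Sum>i\<le>degree p. real_of_int (coeff p i) * x ^ i)"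
    by (simp add: poly_altdef degree_map_poly coeff_map_poly)
  also have "\<dots> = (\<Sum>i\<le>n. real_of_int (coeff p i) * x ^ i)"
    using assms by (intro sum.mono_neutral_left) (auto simp: coeff_eq_0)
  finally show ?thesis .
qed

lemma algebraic_minimal_int_poly:
  fixes \<theta> :: real
  assumes "algebraic \<theta>"
  obtains p :: "int poly" where "p \<noteq> 0" "poly (map_poly real_of_int p) \<theta> = 0"
    "\<And>q :: int poly. q \<noteq> 0 \<Longrightarrow> degree q < degree p \<Longrightarrow> poly (map_poly real_of_int q) \<theta> \<noteq> 0"
proof -
  define R where "R p \<longleftrightarrow> p \<noteq> 0 \<and> poly (map_poly real_of_int p) \<theta> = 0" for p :: "int poly"
  obtain p0 where p0: "\<And>i. coeff p0 i \<in> \<int>" "p0 \<noteq> 0" "poly p0 \<theta> = 0"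
    using assms by (auto simp: algebraic_def)
  have "map_poly real_of_int (map_poly floor p0) = p0"
    using p0(1) by (intro poly_eqI) (simp add: coeff_map_poly)
  with p0 have "R (map_poly floor p0)" by (auto simp: R_def)
  then obtain p where "R p" "\<And>q. R q \<Longrightarrow> degree p \<le> degree q"
    using ex_has_least_nat [of R _ degree] by blast
  then show ?thesis by (intro that [of p]) (force simp: R_def)+
qed

text \<open>The product of the leading coefficient and \<theta> is an algebraic integer. Each new
  factor creates a single term beyond the basis, and that term already carries the leading
  coefficient needed to rewrite it by the equation of \<theta> without division.\<close>

lemma lead_coeff_power_reduce:
  fixes p :: "int poly" and \<theta> :: real
  assumes "degree p = Suc e" "poly (map_poly real_of_int p) \<theta> = 0"
  shows "\<exists>r :: nat \<Rightarrow> int. (real_of_int (lead_coeff p) * \<theta>) ^ n = (\<Sum>j<Suc e. real_of_int (r j) * \<theta> ^ j)"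
proof (induction n)
  case 0
  have "(\<Sum>j<Suc e. real_of_int (if j = 0 then 1 else 0) * \<theta> ^ j) = 1"
    by (subst sum.lessThan_Suc_shift) simp
  then show ?case by (metis power_0)
next
  case (Suc n)
  define a where "a = real_of_int (lead_coeff p)"
  from Suc obtain r :: "nat \<Rightarrow> int" where r: "(a * \<theta>) ^ n = (\<Sum>j<Suc e. r j * \<theta> ^ j)"
    by (auto simp: a_def)
  have top: "a * \<theta> ^ Suc e = - (\<Sum>j<Suc e. coeff p j * \<theta> ^ j)"
  proof -
    have "0 = (\<Sum>j\<le>Suc e. coeff p j * \<theta> ^ j)"
      using assms by (simp only: poly_of_int_altdef [OF order_refl])
    also have "\<dots> = (\<Sum>j<Suc e. coeff p j * \<theta> ^ j) + a * \<theta> ^ Suc e"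
      using assms(1) by (simp add: a_def lessThan_Suc_atMost [symmetric])
    finally show ?thesis by linarith
  qed
  define r' where "r' j = (if j = 0 then 0 else lead_coeff p * r (j - 1)) - r e * coeff p j" for j
  have "(a * \<theta>) ^ Suc n = (\<Sum>j<e. a * r j * \<theta> ^ Suc j) + r e * (a * \<theta> ^ Suc e)"
    by (simp only: power_Suc r) (simp add: sum_distrib_left algebra_simps)
  also have "(\<Sum>j<e. a * r j * \<theta> ^ Suc j)
      = (\<Sum>j<Suc e. real_of_int (if j = 0 then 0 else lead_coeff p * r (j - 1)) * \<theta> ^ j)"
    by (subst sum.lessThan_Suc_shift) (simp add: a_def)
  also have "\<dots> + r e * (a * \<theta> ^ Suc e) = (\<Sum>j<Suc e. r' j * \<theta> ^ j)"
    unfolding top r'_def of_int_diff left_diff_distrib sum_subtractf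
    by (simp add: sum_distrib_left algebra_simps del: sum.lessThan_Suc)
  finally show ?case by (auto simp: a_def)
qed

text \<open>
  With $p$ of minimal degree $d$ and leading coefficient $a$, a power of $a$ times $A(\<theta>) \<theta>^i$ is an integer
  combination of $1, \<theta>, \<dots>, \<theta>^{d-1}$ for each $i < d$. Siegel's lemma yields small weights $w_i$ that
  cancel all but the constant term, and what remains is a nonzero integer.
\<close>

lemma algebraic_lower_bound:
  fixes \<theta> :: real
  assumes "algebraic \<theta>"
  obtains K :: nat where
    "\<And>N. \<exists>\<kappa>>0. \<forall>H\<ge>1. \<forall>A :: int poly. degree A \<le> N \<longrightarrow> (\<forall>i. \<bar>coeff A i\<bar> \<le> int H) \<longrightarrow>
       poly (map_poly real_of_int A) \<theta> \<noteq> 0 \<longrightarrow>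
       \<kappa> / real H ^ K \<le> \<bar>poly (map_poly real_of_int A) \<theta>\<bar>"
proof -
  obtain p :: "int poly" where p: "p \<noteq> 0" "poly (map_poly real_of_int p) \<theta> = 0"
    and min: "\<And>q :: int poly. q \<noteq> 0 \<Longrightarrow> degree q < degree p \<Longrightarrow> poly (map_poly real_of_int q) \<theta> \<noteq> 0"
    using algebraic_minimal_int_poly [OF assms] by blast
  have "degree p \<noteq> 0"
  proof
    assume "degree p = 0"
    with p have "coeff p 0 = 0" using poly_of_int_altdef [of p 0 \<theta>] by simp
    with \<open>degree p = 0\<close> p(1) show False by (metis leading_coeff_0_iff)
  qed
  then obtain e where e: "degree p = Suc e" using not0_implies_Suc by blast
  define a where "a = lead_coeff p"
  have a: "a \<noteq> 0" using p by (simp add: a_def)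
  obtain r :: "nat \<Rightarrow> nat \<Rightarrow> int" where
    r: "\<And>n. (a * \<theta>) ^ n = (\<Sum>j<Suc e. real_of_int (r n j) * \<theta> ^ j)"
    unfolding a_def using lead_coeff_power_reduce [OF e p(2)] by metis
  \<comment> \<open>The exponent \<open>e\<close> is the same for every \<open>N\<close>; the degree
    bound influences only \<kappa>. The transcendence proof relies on this order of quantifiers,
    since it picks \<open>N\<close> in terms of the exponent.\<close>
  have "\<exists>\<kappa>>0. \<forall>H\<ge>1. \<forall>A :: int poly. degree A \<le> N \<longrightarrow> (\<forall>i. \<bar>coeff A i\<bar> \<le> int H) \<longrightarrow>
       poly (map_poly real_of_int A) \<theta> \<noteq> 0 \<longrightarrow>
       \<kappa> / real H ^ e \<le> \<bar>poly (map_poly real_of_int A) \<theta>\<bar>" for N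
  proof -
    \<comment> \<open>The products of \<open>A(\<theta>)\<close> with \<theta>^i for
      \<open>i \<le> e\<close> involve powers of \<theta> up to \<open>N + e\<close>, and reducing
      such a power consumes as many factors \<open>a\<close>.\<close>
    define L where "L = N + e"
    define R where "R = 1 + (\<Sum>n\<le>L. \<Sum>j\<le>e. nat \<bar>r n j\<bar>)"
    define C where "C = (N + 1) * nat \<bar>a\<bar> ^ L * R"
    define V where "V = (1 + \<bar>\<theta>\<bar>) ^ e"
    define D where "D = \<bar>real_of_int a\<bar> ^ L * (Suc e * ((Suc e * C) ^ e * V))"
    have C: "C \<ge> 1" using a by (simp add: C_def R_def Suc_le_eq)
    have V: "V > 0" by (simp add: V_def add_pos_nonneg)
    have D: "D > 0" using C V a unfolding D_def by (intro mult_pos_pos) (auto intro!: zero_less_power add_pos_nonneg)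
    have r_le: "\<bar>r n j\<bar> \<le> int R" if "n \<le> L" "j \<le> e" for n j
    proof -
      have "nat \<bar>r n j\<bar> \<le> (\<Sum>j\<le>e. nat \<bar>r n j\<bar>)" using that by (intro member_le_sum) auto
      also have "\<dots> \<le> (\<Sum>n\<le>L. \<Sum>j\<le>e. nat \<bar>r n j\<bar>)"
        using that by (intro member_le_sum [where f = "\<lambda>n. \<Sum>j\<le>e. nat \<bar>r n j\<bar>"]) auto
      finally have "nat \<bar>r n j\<bar> \<le> R" unfolding R_def by linarith
      then show ?thesis by linarith
    qed
    have "1 / D / real H ^ e \<le> \<bar>poly (map_poly real_of_int A) \<theta>\<bar>"
      if H: "H \<ge> 1" and A: "degree A \<le> N" "\<And>i. \<bar>coeff A i\<bar> \<le> int H"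
        and nz: "poly (map_poly real_of_int A) \<theta> \<noteq> 0" for H and A :: "int poly"
    proof -
      define \<alpha> where "\<alpha> = poly (map_poly real_of_int A) \<theta>"
      define M where "M i j = (\<Sum>k\<le>N. coeff A k * a ^ (L - i - k) * r (i + k) j)" for i j
      have M: "a ^ L * \<theta> ^ i * \<alpha> = (\<Sum>j<Suc e. M i j * \<theta> ^ j)" if "i \<le> e" for i
      proof -
        have "a ^ L * \<theta> ^ i * \<alpha> = (\<Sum>k\<le>N. coeff A k * a ^ (L - i - k) * (a * \<theta>) ^ (i + k))"
        proof -
          have "\<alpha> = (\<Sum>k\<le>N. coeff A k * \<theta> ^ k)"
            unfolding \<alpha>_def by (rule poly_of_int_altdef [OF A(1)])
          moreover have "real_of_int a ^ L = a ^ (L - i - k) * a ^ (i + k)" if "k \<le> N" for k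
            using that \<open>i \<le> e\<close> by (simp add: L_def flip: power_add)
          ultimately show ?thesis
            by (auto simp: sum_distrib_left power_mult_distrib power_add intro!: sum.cong)
        qed
        also have "\<dots> = (\<Sum>k\<le>N. \<Sum>j<Suc e. coeff A k * a ^ (L - i - k) * r (i + k) j * \<theta> ^ j)"
          by (simp only: r sum_distrib_left mult.assoc of_int_mult)
        also have "\<dots> = (\<Sum>j<Suc e. M i j * \<theta> ^ j)"
          by (subst sum.swap) (simp add: M_def sum_distrib_right)
        finally show ?thesis .
      qed
      have M_le: "\<bar>M i j\<bar> \<le> int (C * H)" if "i \<le> e" "j \<le> e" for i j
      proof -
        have "\<bar>M i j\<bar> \<le> (\<Sum>k\<le>N. \<bar>coeff A k * a ^ (L - i - k) * r (i + k) j\<bar>)"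
          unfolding M_def by (rule sum_abs)
        also have "\<dots> \<le> (\<Sum>k\<le>N. int H * \<bar>a\<bar> ^ L * int R)"
          unfolding abs_mult power_abs [symmetric]
        proof (intro sum_mono mult_mono A r_le that)
          fix k assume "k \<in> {..N}"
          then show "i + k \<le> L" using that by (simp add: L_def)
          show "\<bar>a ^ (L - i - k)\<bar> \<le> \<bar>a ^ L\<bar>"
            unfolding power_abs using a by (intro power_increasing) auto
        qed auto
        also have "\<dots> = int (C * H)" by (simp add: C_def algebra_simps)
        finally show ?thesis .
      qed
      obtain w where w: "\<exists>i\<in>{..e}. w i \<noteq> 0" "\<And>j. j \<in> {1..e} \<Longrightarrow> (\<Sum>i\<le>e. M i j * w i) = 0"
        "\<And>i. i \<in> {..e} \<Longrightarrow> \<bar>w i\<bar> \<le> int ((card {..e} * (C * H)) ^ card {1..e})"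
      proof (rule siegel_lemma [of "{..e}" "{1..e}" "C * H" "\<lambda>j i. M i j"])
        show "1 \<le> C * H" using C H by simp
        show "\<bar>M i j\<bar> \<le> int (C * H)" if "i \<in> {..e}" "j \<in> {1..e}" for i j
          using that by (intro M_le) auto
      qed (simp, simp, simp, rule that)
      define W where "W = (\<Sum>i\<le>e. monom (w i) i)"
      have coeff_W: "coeff W i = (if i \<le> e then w i else 0)" for i
        by (simp add: W_def coeff_sum)
      have "W \<noteq> 0" using w(1) coeff_W by (metis atMost_iff coeff_0)
      moreover have deg_W: "degree W \<le> e" by (intro degree_le) (simp add: coeff_W)
      \<comment> \<open>\<open>W\<close> has degree at most \<open>e\<close>, below that of the
        minimal \<open>p\<close>, so it cannot vanish at \<theta>. This is what makes the integer
        \<open>k\<close> below nonzero.\<close>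
      ultimately have W0: "poly (map_poly real_of_int W) \<theta> \<noteq> 0" by (intro min) (auto simp: e)
      have W_eq: "poly (map_poly real_of_int W) \<theta> = (\<Sum>i\<le>e. w i * \<theta> ^ i)"
        by (simp add: poly_of_int_altdef [OF deg_W] coeff_W)
      have "a ^ L * poly (map_poly real_of_int W) \<theta> * \<alpha> = (\<Sum>i\<le>e. w i * (a ^ L * \<theta> ^ i * \<alpha>))"
        by (simp add: W_eq sum_distrib_left sum_distrib_right algebra_simps)
      also have "\<dots> = (\<Sum>i\<le>e. \<Sum>j<Suc e. w i * (M i j * \<theta> ^ j))"
        by (intro sum.cong refl) (simp only: M sum_distrib_left atMost_iff)
      also have "\<dots> = (\<Sum>j<Suc e. of_int (\<Sum>i\<le>e. M i j * w i) * \<theta> ^ j)"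
        by (subst sum.swap) (simp add: sum_distrib_left sum_distrib_right algebra_simps)
      also have "\<dots> = of_int (\<Sum>i\<le>e. M i 0 * w i)"
        by (subst sum.lessThan_Suc_shift) (simp add: w(2) del: of_int_sum)
      finally obtain k :: int where eq: "a ^ L * poly (map_poly real_of_int W) \<theta> * \<alpha> = of_int k" by blast
      have "of_int k \<noteq> (0 :: real)"
        unfolding eq [symmetric] using a W0 nz by (simp add: \<alpha>_def)
      then have "1 \<le> \<bar>k\<bar>" by simp
      then have "1 \<le> \<bar>real_of_int k\<bar>" by linarith
      then have one_le: "1 \<le> \<bar>real_of_int a\<bar> ^ L * \<bar>poly (map_poly real_of_int W) \<theta>\<bar> * \<bar>\<alpha>\<bar>"
        unfolding eq [symmetric] by (simp add: abs_mult power_abs)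
      have "\<bar>poly (map_poly real_of_int W) \<theta>\<bar> \<le> (\<Sum>i\<le>e. \<bar>w i * \<theta> ^ i\<bar>)"
        unfolding W_eq by (rule sum_abs)
      also have "\<dots> \<le> (\<Sum>i\<le>e. (Suc e * (C * H)) ^ e * V)"
      proof (rule sum_mono)
        fix i assume i: "i \<in> {..e}"
        have "real_of_int \<bar>w i\<bar> \<le> real_of_int (int ((Suc e * (C * H)) ^ e))"
          unfolding of_int_le_iff using w(3) [OF i] by simp
        moreover have "\<bar>\<theta>\<bar> ^ i \<le> V"
          unfolding V_def using i by (intro order_trans [OF power_mono power_increasing]) auto
        ultimately show "\<bar>w i * \<theta> ^ i\<bar> \<le> (Suc e * (C * H)) ^ e * V"
          unfolding abs_mult power_abs by (intro mult_mono) auto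
      qed
      also have "\<dots> = Suc e * ((Suc e * C) ^ e * V) * H ^ e"
      proof -
        have "(Suc e * (C * H)) ^ e = (Suc e * C) ^ e * H ^ e"
          by (simp only: power_mult_distrib mult.assoc)
        then show ?thesis by (simp only: sum_constant of_nat_mult of_nat_power card_atMost mult_ac)
      qed
      finally have "\<bar>real_of_int a\<bar> ^ L * \<bar>poly (map_poly real_of_int W) \<theta>\<bar> \<le> D * H ^ e"
        unfolding D_def by (simp add: mult_left_mono mult.assoc)
      from one_le mult_right_mono [OF this, of "\<bar>\<alpha>\<bar>"] have "1 \<le> D * H ^ e * \<bar>\<alpha>\<bar>" by simp
      then show ?thesis using D H by (simp add: \<alpha>_def field_simps)
    qed
    then show ?thesis using D by (intro exI [of _ "1 / D"]) auto
  qed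
  then show ?thesis by (rule that)
qed

section \<open>Irrationality exponents\<close>

text \<open>Dirichlet's theorem gives infinitely many reduced pairs \<open>(h, k)\<close> with error
  below \<open>1 / k^2\<close>. Each is the \<open>quotient_of\<close> of a rational in the set for
  exponent 2, so this set is infinite and 2 itself takes part in the supremum.\<close>

lemma irrationality_exponent_ge_2:
  assumes "\<theta> \<notin> \<rat>"
  shows "irrationality_exponent \<theta> \<ge> 2"
proof -
  have inf: "infinite (approx_set \<theta>)" using assms rational_iff_finite_approx_set by blast
  let ?S = "{r::rat. \<bar>\<theta> - real_of_rat r\<bar> < real_of_int (snd (quotient_of r)) powr (- 2)}"
  have "approx_set \<theta> \<subseteq> quotient_of ` ?S"
  proof
    fix x assume "x \<in> approx_set \<theta>"
    then obtain h k where x: "x = (h, k)" and k: "k > 0" "coprime h k" "\<bar>\<theta> - h / k\<bar> < 1 / k\<^sup>2"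
      by (auto simp: approx_set_def)
    have q: "quotient_of (Rat.Fract h k) = (h, k)"
      using k by (simp add: quotient_of_Fract normalize_def)
    have "real_of_int k powr - 2 = 1 / k\<^sup>2"
      using k(1) by (simp add: powr_minus powr_numeral divide_inverse)
    then have "Rat.Fract h k \<in> ?S" using k by (simp add: q of_rat_rat)
    then show "x \<in> quotient_of ` ?S" using q x by (intro image_eqI [of _ _ "Rat.Fract h k"]) auto
  qed
  then have "infinite ?S" using inf finite_surj by blast
  then show ?thesis
    unfolding irrationality_exponent_def by (intro Sup_upper image_eqI [of _ _ 2]) auto
qed

lemma finite_rats_denominator_bound:
  "finite {r::rat. snd (quotient_of r) \<le> V \<and> \<bar>\<theta> - real_of_rat r\<bar> < 1}" (is "finite ?S")
proof -
  define U where "U = \<lceil>V * (\<bar>\<theta>\<bar> + 1)\<rceil>"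
  have "quotient_of ` ?S \<subseteq> {-U..U} \<times> {0..V}"
  proof
    fix x assume "x \<in> quotient_of ` ?S"
    then obtain r where r: "x = quotient_of r" "snd x \<le> V" "\<bar>\<theta> - real_of_rat r\<bar> < 1" by auto
    obtain u v where uv: "x = (u, v)" by (cases x)
    have v: "v > 0" using quotient_of_denom_pos' [of r] r(1) uv by (metis snd_conv)
    have "r = of_int u / of_int v" using quotient_of_div r uv by metis
    then have "real_of_rat r = u / v" by (simp add: of_rat_divide)
    with r(3) have "\<bar>u / v\<bar> \<le> \<bar>\<theta>\<bar> + 1" by linarith
    then have "\<bar>real_of_int u\<bar> \<le> v * (\<bar>\<theta>\<bar> + 1)"
      using v by (simp add: field_simps)
    also have "\<dots> \<le> V * (\<bar>\<theta>\<bar> + 1)"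
      using r(2) uv by (intro mult_right_mono) auto
    finally have "\<bar>u\<bar> \<le> U" unfolding U_def by linarith
    with v r(2) uv show "x \<in> {-U..U} \<times> {0..V}" by auto
  qed
  then have "finite (quotient_of ` ?S)" by (rule finite_subset) auto
  then show ?thesis
    by (rule finite_imageD) (auto simp: inj_on_def quotient_of_inject_eq)
qed

text \<open>A fraction \<open>u / v\<close> that is too close to \<theta> is compared with the pair
  \<open>(p, q)\<close> that the hypothesis supplies for this very \<open>v\<close>. If
  \<open>q * u - p * v\<close> is nonzero, it has absolute value at least 1, yet it splits into a
  part of size at most 1/2 and a part \<open>|q| * |v * \<theta> - u|\<close> that tends to 0. If it
  is zero, \<open>v * |q * \<theta> - p|\<close> equals \<open>|q| * |v * \<theta> - u|\<close>,
  which contradicts the lower bound in the hypothesis. Hence the denominators \<open>v\<close> are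
  bounded.\<close>

lemma irrationality_exponent_le_2:
  fixes \<theta> :: real
  assumes approx: "\<And>\<kappa>. \<kappa> > 1 \<Longrightarrow> \<forall>\<^sub>F v in sequentially. \<exists>(p::int) (q::int). real v * \<bar>q * \<theta> - p\<bar> \<le> 1/2 \<and>
    \<bar>real_of_int q\<bar> \<le> real v powr \<kappa> \<and> real v powr (- \<kappa>) \<le> \<bar>q * \<theta> - p\<bar>"
  shows "irrationality_exponent \<theta> \<le> 2"
proof -
  have "finite {r::rat. \<bar>\<theta> - real_of_rat r\<bar> < real_of_int (snd (quotient_of r)) powr (- \<mu>)}"
    if \<mu>: "\<mu> > 2" for \<mu>
  proof -
    \<comment> \<open>Half of \<mu> makes \<open>\<kappa> + (1 - \<mu>) = 1 - \<kappa>\<close>: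
      negative, as the case of a nonzero determinant requires, and equal to the exponent that the
      lower bound yields in the other case.\<close>
    define \<kappa> where "\<kappa> = \<mu> / 2"
    have \<kappa>: "\<kappa> > 1" "\<mu> = 2 * \<kappa>" using \<mu> by (auto simp: \<kappa>_def)
    have "\<forall>\<^sub>F v in sequentially. real v powr (1 - \<kappa>) < 1/2"
      using \<kappa> by real_asymp
    then have "\<forall>\<^sub>F v in sequentially. real v powr (1 - \<kappa>) < 1/2 \<and> (\<exists>(p::int) (q::int).
        real v * \<bar>q * \<theta> - p\<bar> \<le> 1/2 \<and> \<bar>real_of_int q\<bar> \<le> real v powr \<kappa> \<and> real v powr (- \<kappa>) \<le> \<bar>q * \<theta> - p\<bar>)"
      using approx [OF \<kappa>(1)] by (rule eventually_conj)
    then obtain V :: nat where V: "\<And>v. v \<ge> V \<Longrightarrow> real v powr (1 - \<kappa>) < 1/2 \<and> (\<exists>(p::int) (q::int).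
        real v * \<bar>q * \<theta> - p\<bar> \<le> 1/2 \<and> \<bar>real_of_int q\<bar> \<le> real v powr \<kappa> \<and> real v powr (- \<kappa>) \<le> \<bar>q * \<theta> - p\<bar>)"
      unfolding eventually_sequentially by blast
    have "snd (quotient_of r) \<le> int V \<and> \<bar>\<theta> - real_of_rat r\<bar> < 1"
      if r: "\<bar>\<theta> - real_of_rat r\<bar> < real_of_int (snd (quotient_of r)) powr (- \<mu>)" for r
    proof
      obtain u v where uv: "quotient_of r = (u, v)" by (cases "quotient_of r")
      have v: "v > 0" using quotient_of_denom_pos uv by blast
      have "r = of_int u / of_int v" using quotient_of_div uv by blast
      then have ruv: "real_of_rat r = u / v" by (simp add: of_rat_divide)
      have "real_of_int v powr (- \<mu>) \<le> real_of_int v powr 0"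
        using v \<mu> by (intro powr_mono) auto
      then show "\<bar>\<theta> - real_of_rat r\<bar> < 1" using r v by (simp add: uv)
      have "v * \<bar>\<theta> - u / v\<bar> < v * real_of_int v powr (- \<mu>)"
        using r v by (simp add: uv ruv)
      also have "\<dots> = real_of_int v powr (1 - \<mu>)"
        using v by (simp add: powr_diff powr_minus divide_inverse)
      also have "v * \<bar>\<theta> - u / v\<bar> = \<bar>v * \<theta> - u\<bar>"
      proof -
        have "v * \<bar>\<theta> - u / v\<bar> = \<bar>v * (\<theta> - u / v)\<bar>" using v by (simp add: abs_mult)
        also have "v * (\<theta> - u / v) = v * \<theta> - u" using v by (simp add: right_diff_distrib)
        finally show ?thesis .
      qed
      finally have less: "\<bar>v * \<theta> - u\<bar> < real_of_int v powr (1 - \<mu>)" .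
      show "snd (quotient_of r) \<le> int V"
      proof (rule ccontr)
        assume "\<not> ?thesis"
        then have "nat v \<ge> V" by (simp add: uv)
        then obtain p q :: int where small: "real_of_int v powr (1 - \<kappa>) < 1/2"
          and pq: "v * \<bar>q * \<theta> - p\<bar> \<le> 1/2" "\<bar>real_of_int q\<bar> \<le> real_of_int v powr \<kappa>"
            "real_of_int v powr (- \<kappa>) \<le> \<bar>q * \<theta> - p\<bar>"
          using V [of "nat v"] v by auto
        have q0: "\<bar>q\<bar> * \<bar>v * \<theta> - u\<bar> \<le> real_of_int v powr \<kappa> * real_of_int v powr (1 - \<mu>)"
          using pq(2) less by (intro mult_mono) auto
        have exp: "real_of_int v powr \<kappa> * real_of_int v powr (1 - \<mu>) = real_of_int v powr (1 - \<kappa>)"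
          by (simp add: powr_add [symmetric] \<kappa>(2))
        show False
        proof (cases "q * u = p * v")
          case True
          have "real_of_int v powr (1 - \<kappa>) = v * real_of_int v powr (- \<kappa>)"
            using v by (simp add: powr_diff powr_minus divide_inverse)
          also have "\<dots> \<le> v * \<bar>q * \<theta> - p\<bar>"
            using pq(3) v by simp
          also have "\<dots> = \<bar>q * (v * \<theta> - u)\<bar>"
          proof -
            have "v * (q * \<theta> - p) = q * (v * \<theta> - u)"
              using True by (simp add: algebra_simps flip: of_int_mult)
            then show ?thesis using v by (metis abs_mult abs_of_pos of_int_0_less_iff)
          qed
          finally have le: "real_of_int v powr (1 - \<kappa>) \<le> \<bar>q\<bar> * \<bar>v * \<theta> - u\<bar>"
            by (simp add: abs_mult)
          have "q \<noteq> 0" using le v by auto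
          then have "\<bar>q\<bar> * \<bar>v * \<theta> - u\<bar> < \<bar>q\<bar> * real_of_int v powr (1 - \<mu>)"
            using less by simp
          also have "\<dots> \<le> real_of_int v powr \<kappa> * real_of_int v powr (1 - \<mu>)"
            using pq(2) by (intro mult_right_mono) auto
          finally show False using le exp by simp
        next
          case False
          then have "1 \<le> \<bar>q * u - p * v\<bar>" by linarith
          then have "1 \<le> \<bar>real_of_int (q * u - p * v)\<bar>" by linarith
          also have "real_of_int (q * u - p * v) = v * (q * \<theta> - p) - q * (v * \<theta> - u)"
            by (simp add: algebra_simps)
          also have "\<bar>\<dots>\<bar> \<le> v * \<bar>q * \<theta> - p\<bar> + \<bar>q\<bar> * \<bar>v * \<theta> - u\<bar>"
            using v abs_triangle_ineq4 [of "v * (q * \<theta> - p)" "q * (v * \<theta> - u)"] by (simp add: abs_mult)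
          also have "\<dots> < 1" using pq(1) q0 exp small by linarith
          finally show False by simp
        qed
      qed
    qed
    then have "{r::rat. \<bar>\<theta> - real_of_rat r\<bar> < real_of_int (snd (quotient_of r)) powr (- \<mu>)}
        \<subseteq> {r. snd (quotient_of r) \<le> int V \<and> \<bar>\<theta> - real_of_rat r\<bar> < 1}" by blast
    then show ?thesis using finite_rats_denominator_bound by (rule finite_subset)
  qed
  then show ?thesis
    unfolding irrationality_exponent_def
    by (intro Sup_least) (auto simp: numeral_eq_ereal not_less [symmetric])
qed

section \<open>The Mahler series modulo 2\<close>

text \<open>Comparison of coefficients in \<open>(1 - z) f(z) = z - z^2 + s f(z^2)\<close>, the
  functional equation with its denominator cleared. For \<open>s = 1\<close> this equation leaves
  the constant term free; it is fixed as 0.\<close>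

fun mahler_coeff :: "int \<Rightarrow> nat \<Rightarrow> int" where
  "mahler_coeff s n = (if n = 0 then 0 else if n = 1 then 1 else
     mahler_coeff s (n - 1) - (if n = 2 then 1 else 0) + (if even n then s * mahler_coeff s (n div 2) else 0))"

declare mahler_coeff.simps [simp del]

text \<open>The ring is a parameter so that one integer sequence serves over \<open>int\<close>,
  over \<open>real\<close> for evaluation and over \<open>bit\<close> for reduction modulo
  2.\<close>

definition mahler_fps :: "int \<Rightarrow> 'a::comm_ring_1 fps" where
  "mahler_fps s = Abs_fps (\<lambda>n. of_int (mahler_coeff s n))"

definition fps_dilate2 :: "'a::comm_ring_1 fps \<Rightarrow> 'a fps" where
  "fps_dilate2 f = Abs_fps (\<lambda>n. if even n then fps_nth f (n div 2) else 0)"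

lemma mahler_coeff_0 [simp]: "mahler_coeff s 0 = 0"
  by (simp add: mahler_coeff.simps)

lemma mahler_fps_nth [simp]: "fps_nth (mahler_fps s) n = of_int (mahler_coeff s n)"
  by (simp add: mahler_fps_def)

lemma fps_dilate2_nth [simp]: "fps_nth (fps_dilate2 f) n = (if even n then fps_nth f (n div 2) else 0)"
  by (simp add: fps_dilate2_def)

lemma mahler_fps_eq:
  "(1 - fps_X) * mahler_fps s = fps_X - fps_X\<^sup>2 + fps_const (of_int s) * fps_dilate2 (mahler_fps s)"
proof (rule fps_ext)
  fix n
  have "mahler_coeff s n - (if n = 0 then 0 else mahler_coeff s (n - 1)) =
     (if n = 1 then 1 else 0) - (if n = 2 then 1 else 0) + (if even n then s * mahler_coeff s (n div 2) else 0)"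
    by (subst (1) mahler_coeff.simps) auto
  from arg_cong [OF this, of "of_int :: int \<Rightarrow> 'a"]
  show "((1 - fps_X) * mahler_fps s) $ n =
      (fps_X - fps_X\<^sup>2 + fps_const (of_int s :: 'a) * fps_dilate2 (mahler_fps s)) $ n"
    by (simp add: left_diff_distrib fps_X_power_iff split: if_splits)
qed

text \<open>Terms with indices \<open>i\<close> and \<open>n - i\<close> cancel in characteristic 2,
  so only a middle index survives. Accordingly the induction strips the first and the last term
  together.\<close>

lemma sum_symmetric_bit:
  fixes g :: "nat \<Rightarrow> bit"
  assumes "\<And>i. i \<le> n \<Longrightarrow> g (n - i) = g i"
  shows "(\<Sum>i\<le>n. g i) = (if even n then g (n div 2) else 0)"
  using assms
proof (induction n arbitrary: g rule: induct_nat_012)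
  case 1
  then have "g 1 = g 0" by force
  then show ?case by simp
next
  case (ge2 n)
  have "g (Suc (Suc n)) = g 0" using ge2.prems [of 0] by simp
  moreover have "(\<Sum>i\<le>Suc (Suc n). g i) = g 0 + ((\<Sum>i\<le>n. g (Suc i)) + g (Suc (Suc n)))"
    by (subst sum.atMost_Suc, subst sum.atMost_Suc_shift) (rule add.assoc)
  ultimately have "(\<Sum>i\<le>Suc (Suc n). g i) = (\<Sum>i\<le>n. g (Suc i))"
    by (cases "g 0"; simp)
  also have "\<dots> = (if even n then g (Suc (n div 2)) else 0)"
  proof (rule ge2.IH)
    show "g (Suc (n - i)) = g (Suc i)" if "i \<le> n" for i
      using ge2.prems [of "Suc i"] that by (simp add: Suc_diff_le)
  qed
  finally show ?case by simp
qed auto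

text \<open>Frobenius over the field with two elements: mixed products cancel in pairs and each
  coefficient is its own square.\<close>

lemma fps_square_bit: "(f :: bit fps)\<^sup>2 = fps_dilate2 f"
proof (rule fps_ext)
  fix n
  have "f\<^sup>2 $ n = (\<Sum>i\<le>n. f $ i * f $ (n - i))"
    by (simp only: power2_eq_square fps_mult_nth atMost_atLeast0)
  also have "\<dots> = (if even n then f $ (n div 2) * f $ (n - n div 2) else 0)"
    by (rule sum_symmetric_bit) (metis diff_diff_cancel mult.commute)
  also have "\<dots> = fps_dilate2 f $ n"
    by (auto elim!: evenE)
  finally show "f\<^sup>2 $ n = fps_dilate2 f $ n" .
qed

lemma coeff_mult_degree_bounds:
  fixes p q :: "'a::comm_semiring_0 poly"
  assumes "degree p \<le> m" "degree q \<le> n"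
  shows "coeff (p * q) (m + n) = coeff p m * coeff q n"
proof (cases "degree p = m \<and> degree q = n")
  case True
  then show ?thesis using coeff_mult_degree_sum by blast
next
  case False
  then have "degree (p * q) < m + n"
    using assms degree_mult_le [of p q] by linarith
  moreover have "coeff p m = 0 \<or> coeff q n = 0"
    using False assms by (metis coeff_eq_0 le_neq_implies_less)
  ultimately show ?thesis by (auto simp: coeff_eq_0)
qed

text \<open>
  If the coefficients of $P$ and $Q$ at degrees $e + 1$ and $e$ are $x$ and $y$, then the coefficient at
  degree $2e + 2$ is $x^2 + x y + y^2$, which is anisotropic over the field with two elements.
\<close>

lemma norm_form_bit_nonzero:
  fixes P Q :: "bit poly"
  assumes "Q \<noteq> 0"
  shows "P\<^sup>2 + [:1, 1:] * (P * Q) + [:0, 1, 1:] * Q\<^sup>2 \<noteq> 0"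
proof -
  \<comment> \<open>The least \<open>e\<close> satisfying both degree bounds, so that at least one
    of the two coefficients considered is a true leading coefficient. The difference of one between
    the bounds brings all three summands to the same top degree \<open>2 * e + 2\<close>.\<close>
  define e where "e = max (degree P - 1) (degree Q)"
  have d: "degree P \<le> Suc e" "degree Q \<le> e" by (auto simp: e_def)
  have "coeff (P\<^sup>2) (Suc e + Suc e) = coeff P (Suc e) * coeff P (Suc e)"
    unfolding power2_eq_square by (intro coeff_mult_degree_bounds d)
  moreover have "coeff ([:1, 1:] * (P * Q)) (1 + (Suc e + e)) = 1 * (coeff P (Suc e) * coeff Q e)"
    by (subst coeff_mult_degree_bounds)
      (use d in \<open>auto simp: coeff_mult_degree_bounds [OF d, simplified] intro: order_trans [OF degree_mult_le]\<close>)
  moreover have "coeff ([:0, 1, 1:] * Q\<^sup>2) (2 + (e + e)) = 1 * (coeff Q e * coeff Q e)"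
    unfolding power2_eq_square
    by (subst coeff_mult_degree_bounds)
      (use d in \<open>auto simp: coeff_mult_degree_bounds [OF d(2) d(2)] numeral_2_eq_2 intro: order_trans [OF degree_mult_le]\<close>)
  ultimately have "coeff (P\<^sup>2 + [:1, 1:] * (P * Q) + [:0, 1, 1:] * Q\<^sup>2) (2 + (e + e)) =
      coeff P (Suc e) * coeff P (Suc e) + coeff P (Suc e) * coeff Q e + coeff Q e * coeff Q e"
    by simp
  moreover have "coeff P (Suc e) \<noteq> 0 \<or> coeff Q e \<noteq> 0"
  proof (cases "degree P \<le> e")
    case True
    then have "e = degree Q" by (auto simp: e_def)
    then show ?thesis using assms by simp
  next
    case False
    then have "Suc e = degree P" using d by simp
    then show ?thesis by (metis Zero_not_Suc degree_0 leading_coeff_0_iff)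
  qed
  ultimately have "coeff (P\<^sup>2 + [:1, 1:] * (P * Q) + [:0, 1, 1:] * Q\<^sup>2) (2 + (e + e)) \<noteq> 0"
    by (simp only:) (cases "coeff P (Suc e)"; cases "coeff Q e"; simp)
  then show ?thesis by (metis coeff_0)
qed

text \<open>The remainder divides the norm, a polynomial of degree at most \<open>2 * n + 2\<close>.
  If the remainder vanished beyond that degree, the norm would be zero, which the anisotropic top
  coefficient excludes.\<close>

lemma mahler_fps_bit_approx:
  fixes P Q :: "bit poly" and s :: int
  assumes s: "odd s" and Q: "Q \<noteq> 0" and deg: "degree P \<le> n" "degree Q \<le> n"
  shows "\<exists>k\<le>2*n+2. (fps_of_poly Q * mahler_fps s - fps_of_poly P) $ k \<noteq> 0"
proof (rule ccontr)
  define F :: "bit fps" where "F = mahler_fps s"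
  define p q where "p = fps_of_poly P" and "q = fps_of_poly Q"
  define N where "N = P\<^sup>2 + [:1, 1:] * (P * Q) + [:0, 1, 1:] * Q\<^sup>2"
  assume "\<not> ?thesis"
  then have zero: "(q * F - p) $ k = 0" if "k \<le> 2 * n + 2" for k
    using that by (simp add: F_def p_def q_def)
  have two: "(2 :: bit fps) = 0" by (simp add: numeral_fps_const)
  have "(of_int s :: bit) = 1" using s by (cases "of_int s :: bit") (auto elim!: oddE)
  then have F: "(1 - fps_X) * F = fps_X - fps_X\<^sup>2 + F\<^sup>2"
    using mahler_fps_eq [of s, where 'a = bit]
    by (simp only: F_def fps_square_bit [of "mahler_fps s"] fps_const_1_eq_1 mult_1_left)
  have N: "fps_of_poly N = p\<^sup>2 + (1 + fps_X) * (p * q) + fps_X * (1 + fps_X) * q\<^sup>2"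
    by (simp add: N_def p_def q_def fps_of_poly_simps fps_of_poly_pCons algebra_simps)
  \<comment> \<open>\<open>F + 1 + fps_X\<close> is the second root of the quadratic equation, since
    the two roots sum to \<open>1 + fps_X\<close> in characteristic 2. Keeping the factor 2 on the
    right makes this a plain ring identity; it is set to zero only afterwards.\<close>
  have "fps_of_poly N + (q * F - p) * (q * (F + 1 + fps_X) + p) = 2 * (q\<^sup>2 * F + fps_X\<^sup>2 * q\<^sup>2)"
    using F unfolding N by algebra
  then have N_eq: "fps_of_poly N = - ((q * F - p) * (q * (F + 1 + fps_X) + p))"
    by (simp add: two eq_neg_iff_add_eq_0)
  have "coeff N k = 0" for k
  proof (cases "k \<le> 2 * n + 2")
    case True
    have "coeff N k = fps_of_poly N $ k" by simp
    also have "\<dots> = 0" using True unfolding N_eq by (simp add: fps_mult_nth zero del: fps_sub_nth)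
    finally show ?thesis .
  next
    case False
    have "degree N \<le> 2 * n + 2"
      unfolding N_def power2_eq_square using deg
      by (intro degree_add_le order_trans [OF degree_mult_le]) (auto intro!: order_trans [OF degree_mult_le])
    with False show ?thesis by (simp add: coeff_eq_0)
  qed
  then have "N = 0" by (simp add: poly_eqI)
  then show False using norm_form_bit_nonzero [OF Q, of P] by (simp add: N_def)
qed

section \<open>Integer Pade approximants with controlled order\<close>

lemma mahler_fps_approx_of_int:
  "(fps_of_poly (map_poly of_int Q) * mahler_fps s - fps_of_poly (map_poly of_int P)) $ k =
   (of_int ((fps_of_poly Q * mahler_fps s - fps_of_poly P) $ k) :: 'a::comm_ring_1)"
  by (simp add: fps_mult_nth coeff_map_poly)

text \<open>The \<open>n + 1\<close> coefficients of \<open>Q\<close> can satisfy the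
  \<open>n\<close> conditions that coefficients \<open>n + 1\<close> to \<open>2 * n\<close> of
  \<open>Q f\<close> vanish, and \<open>P\<close> takes the part up to degree \<open>n\<close>. The
  upper bound on the order comes from modulo 2: a remainder coefficient that is nonzero there is
  nonzero over the integers.\<close>

lemma mahler_fps_pade:
  assumes s: "odd s"
  obtains P Q :: "int poly" where "degree P \<le> n" "degree Q \<le> n"
    "subdegree (fps_of_poly Q * mahler_fps s - fps_of_poly P) \<in> {2*n+1..2*n+2}"
proof -
  define H where "H = 1 + (\<Sum>k\<le>2*n. nat \<bar>mahler_coeff s k\<bar>)"
  have H: "\<bar>mahler_coeff s k\<bar> \<le> int H" if "k \<le> 2 * n" for k
  proof -
    have "nat \<bar>mahler_coeff s k\<bar> \<le> (\<Sum>k\<le>2*n. nat \<bar>mahler_coeff s k\<bar>)"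
      using that by (intro member_le_sum) auto
    then have "nat \<bar>mahler_coeff s k\<bar> \<le> H" unfolding H_def by linarith
    then show ?thesis by linarith
  qed
  obtain x where x: "\<exists>i\<in>{..n}. x i \<noteq> 0"
    "\<And>j. j \<in> {n+1..2*n} \<Longrightarrow> (\<Sum>i\<le>n. mahler_coeff s (j - i) * x i) = 0"
  proof (rule siegel_lemma [of "{..n}" "{n+1..2*n}" H "\<lambda>j i. mahler_coeff s (j - i)"])
    show "1 \<le> H" by (simp add: H_def)
    show "\<bar>mahler_coeff s (j - i)\<bar> \<le> int H" if "i \<in> {..n}" "j \<in> {n+1..2*n}" for i j
      using that by (intro H) auto
  qed (simp, simp, simp, rule that)
  define Q0 where "Q0 = (\<Sum>i\<le>n. monom (x i) i)"
  have coeff_Q0: "coeff Q0 i = (if i \<le> n then x i else 0)" for i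
    by (simp add: Q0_def coeff_sum)
  have Q0: "Q0 \<noteq> 0" using x(1) coeff_Q0 by (metis atMost_iff coeff_0)
  have Q0_zero: "(fps_of_poly Q0 * mahler_fps s) $ j = 0" if "j \<in> {n+1..2*n}" for j
  proof -
    have "(fps_of_poly Q0 * mahler_fps s) $ j = (\<Sum>i\<in>{0..j}. coeff Q0 i * mahler_coeff s (j - i))"
      by (simp add: fps_mult_nth)
    also have "\<dots> = (\<Sum>i\<le>n. coeff Q0 i * mahler_coeff s (j - i))"
      using that by (intro sum.mono_neutral_right) (auto simp: coeff_Q0)
    also have "\<dots> = (\<Sum>i\<le>n. mahler_coeff s (j - i) * x i)"
      by (intro sum.cong) (auto simp: coeff_Q0)
    finally show ?thesis using x(2) that by simp
  qed
  \<comment> \<open>The solution \<open>Q0\<close> could be divisible by 2 and vanish under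
    reduction; dividing by its content prevents this and keeps the vanishing conditions.\<close>
  define Q where "Q = primitive_part Q0"
  define P where "P = truncate_fps (Suc n) (fps_of_poly Q * mahler_fps s)"
  define D where "D = fps_of_poly Q * mahler_fps s - fps_of_poly P"
  have Q0_Q: "Q0 = smult (Polynomial.content Q0) Q" by (simp add: Q_def)
  have deg_Q: "degree Q \<le> n"
    unfolding Q_def degree_primitive_part by (intro degree_le) (simp add: coeff_Q0)
  have deg_P: "degree P \<le> n"
    using degree_truncate_fps [of "Suc n" "fps_of_poly Q * mahler_fps s"] by (simp add: P_def)
  have Q_zero: "(fps_of_poly Q * mahler_fps s) $ j = 0" if "j \<in> {n+1..2*n}" for j
    using Q0_zero [OF that] Q0 by (subst (asm) Q0_Q) (simp add: fps_of_poly_smult mult.assoc)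
  have D0: "D $ k = 0" if "k < 2 * n + 1" for k
    using that Q_zero [of k] by (cases "k \<le> n") (auto simp: D_def P_def coeff_truncate_fps)
  have "map_poly of_int Q \<noteq> (0 :: bit poly)"
  proof
    assume "map_poly of_int Q = (0 :: bit poly)"
    then have *: "of_int (coeff Q i) = (0 :: bit)" for i
      by (metis coeff_0 coeff_map_poly of_int_0)
    have "even (coeff Q i)" for i
    proof (rule ccontr)
      assume "odd (coeff Q i)"
      then obtain b where "coeff Q i = 2 * b + 1" by (elim oddE)
      with * [of i] show False by simp
    qed
    then have "[:2:] dvd Q"
      unfolding const_poly_dvd_iff by blast
    then have "2 dvd Polynomial.content Q" by (simp add: const_poly_dvd_iff_dvd_content)
    then show False using Q0 by (simp add: Q_def)
  qed
  moreover have "degree (map_poly (of_int :: int \<Rightarrow> bit) P) \<le> n" "degree (map_poly (of_int :: int \<Rightarrow> bit) Q) \<le> n"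
    using deg_P deg_Q by (auto intro!: degree_le simp: coeff_map_poly coeff_eq_0)
  ultimately obtain k where "k \<le> 2 * n + 2"
    "(fps_of_poly (map_poly of_int Q) * mahler_fps s - fps_of_poly (map_poly of_int P)) $ k \<noteq> (0 :: bit)"
    using mahler_fps_bit_approx [OF s] by blast
  then have k: "k \<le> 2 * n + 2" "D $ k \<noteq> 0"
    unfolding mahler_fps_approx_of_int D_def by auto
  then have "subdegree D \<le> 2 * n + 2" using subdegree_leI [of D k] by simp
  moreover have "subdegree D \<ge> 2 * n + 1"
    using k(2) D0 by (intro subdegree_geI) auto
  ultimately show ?thesis using that deg_P deg_Q by (simp add: D_def)
qed

section \<open>The Mahler function\<close>

definition mahler_fun :: "int \<Rightarrow> real \<Rightarrow> real" where
  "mahler_fun s = eval_fps (mahler_fps s)"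

text \<open>The step from \<open>n - 1\<close> to \<open>n\<close> adds a coefficient of index at
  most \<open>n div 2\<close>. Its size, of order \<open>\<rho> ^ (n div 2)\<close>, is absorbed by
  the gap between \<open>\<rho> ^ (n - 1)\<close> and \<open>\<rho> ^ n\<close> for large
  \<open>n\<close>.\<close>

lemma mahler_coeff_bound:
  fixes \<rho> :: real
  assumes s: "\<bar>s\<bar> = 1" and \<rho>: "\<rho> > 1"
  obtains K where "\<And>n. \<bar>real_of_int (mahler_coeff s n)\<bar> \<le> K * \<rho> ^ n"
proof -
  obtain k where k: "\<rho> ^ k > 1 / (\<rho> - 1)" using real_arch_pow [OF \<rho>] by blast
  \<comment> \<open>From here on \<open>n - 1 - n div 2 \<ge> k\<close>, and the exceptional clauses
    of the recursion, which end at index 2, are past.\<close>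
  define n0 where "n0 = 2 * k + 3"
  define K where "K = (\<Sum>n<n0. \<bar>real_of_int (mahler_coeff s n)\<bar>)"
  have K: "K \<ge> 0" by (simp add: K_def sum_nonneg)
  have "\<bar>real_of_int (mahler_coeff s n)\<bar> \<le> K * \<rho> ^ n" for n
  proof (induction n rule: less_induct)
    case (less n)
    show ?case
    proof (cases "n < n0")
      case True
      then have "\<bar>real_of_int (mahler_coeff s n)\<bar> \<le> K"
        unfolding K_def by (intro member_le_sum) auto
      also have "\<dots> \<le> K * \<rho> ^ n" using K \<rho> mult_left_mono [of 1 "\<rho> ^ n" K] by simp
      finally show ?thesis .
    next
      case False
      then have n: "n \<ge> 2 * k + 3" by (simp add: n0_def)
      define c where "c = (if even n then s * mahler_coeff s (n div 2) else 0)"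
      have c: "\<bar>real_of_int c\<bar> \<le> K * \<rho> ^ (n div 2)"
        using less [of "n div 2"] n s K \<rho> by (auto simp: c_def abs_mult simp flip: of_int_abs)
      have "mahler_coeff s n = mahler_coeff s (n - 1) + c"
        using n by (subst mahler_coeff.simps) (auto simp: c_def)
      then have "\<bar>real_of_int (mahler_coeff s n)\<bar> \<le> \<bar>real_of_int (mahler_coeff s (n - 1))\<bar> + \<bar>real_of_int c\<bar>"
        by simp
      also have "\<dots> \<le> K * \<rho> ^ (n - 1) + K * \<rho> ^ (n div 2)"
        using less [of "n - 1"] c n by (intro add_mono) auto
      also have "\<dots> \<le> K * \<rho> ^ n"
      proof -
        have "1 \<le> \<rho> ^ k * (\<rho> - 1)" using k \<rho> by (simp add: field_simps)
        also have "\<dots> \<le> \<rho> ^ (n - 1 - n div 2) * (\<rho> - 1)"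
          using n \<rho> by (intro mult_right_mono power_increasing) auto
        finally have "\<rho> ^ (n div 2) * 1 \<le> \<rho> ^ (n div 2) * (\<rho> ^ (n - 1 - n div 2) * (\<rho> - 1))"
          using \<rho> by (intro mult_left_mono) auto
        also have "\<dots> = \<rho> ^ (n - 1) * (\<rho> - 1)"
          using n by (simp add: mult.assoc [symmetric] power_add [symmetric])
        also have "\<dots> = \<rho> ^ n - \<rho> ^ (n - 1)"
          using n by (cases n) (auto simp: algebra_simps)
        finally show ?thesis using K by (simp add: distrib_left [symmetric] mult_left_mono)
      qed
      finally show ?thesis .
    qed
  qed
  then show ?thesis by (rule that)
qed

lemma conv_radius_mahler_fps:
  assumes s: "\<bar>s\<bar> = 1"
  shows "fps_conv_radius (mahler_fps s :: real fps) \<ge> 1"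
  unfolding fps_conv_radius_def
proof (rule conv_radius_geI_ex)
  fix r :: real assume r: "0 < r" "ereal r < 1"
  \<comment> \<open>The midpoint of 1 and \<open>1 / r\<close>: large enough for the coefficient
    bound, small enough for the geometric series in \<open>\<rho> * r\<close> to converge.\<close>
  define \<rho> where "\<rho> = (1 + 1 / r) / 2"
  have \<rho>: "\<rho> > 1" "\<rho> * r < 1" "\<rho> * r > 0" using r by (auto simp: \<rho>_def field_simps add_pos_pos)
  obtain K where K: "\<And>n. \<bar>real_of_int (mahler_coeff s n)\<bar> \<le> K * \<rho> ^ n"
    using mahler_coeff_bound [OF s \<rho>(1)] by blast
  have "summable (\<lambda>n. mahler_fps s $ n * r ^ n)"
  proof (rule summable_comparison_test' [where g = "\<lambda>n. K * (\<rho> * r) ^ n" and N = 0])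
    show "summable (\<lambda>n. K * (\<rho> * r) ^ n)"
      using \<rho> by (intro summable_mult summable_geometric) auto
    show "norm (mahler_fps s $ n * r ^ n) \<le> K * (\<rho> * r) ^ n" for n
      using mult_right_mono [OF K [of n], of "r ^ n"] r by (simp add: abs_mult power_mult_distrib mult.assoc)
  qed
  then show "\<exists>z::real. norm z = r \<and> summable (\<lambda>n. mahler_fps s $ n * z ^ n)"
    using r by (intro exI [of _ r]) auto
qed

lemma less_conv_radius_mahler_fps:
  fixes x :: real
  assumes "\<bar>s\<bar> = 1" "\<bar>x\<bar> < 1"
  shows "ereal (norm x) < fps_conv_radius (mahler_fps s :: real fps)"
  by (rule less_le_trans [OF _ conv_radius_mahler_fps [OF assms(1)]]) (use assms(2) in simp)

lemma mahler_fun_sums: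
  assumes "\<bar>s\<bar> = 1" "\<bar>x\<bar> < 1"
  shows "(\<lambda>n. real_of_int (mahler_coeff s n) * x ^ n) sums mahler_fun s x"
  using sums_eval_fps [OF less_conv_radius_mahler_fps [OF assms]] by (simp add: mahler_fun_def)

lemma mahler_fun_eq:
  assumes s: "\<bar>s\<bar> = 1" and x: "\<bar>x\<bar> < 1"
  shows "(1 - x) * mahler_fun s x = x * (1 - x) + s * mahler_fun s (x\<^sup>2)"
proof -
  note rad = less_conv_radius_mahler_fps [OF s x, simplified]
  define h :: "real fps" where "h = (1 - fps_X) * mahler_fps s"
  define g :: "real fps" where "g = h - fps_X + fps_X\<^sup>2"
  have h_rad: "ereal \<bar>x\<bar> < fps_conv_radius h"
    unfolding h_def
    by (rule less_le_trans [OF _ fps_conv_radius_mult])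
      (use rad in \<open>auto intro!: less_le_trans [OF _ fps_conv_radius_diff]\<close>)
  have g_rad: "ereal \<bar>x\<bar> < fps_conv_radius g" "ereal \<bar>x\<bar> < fps_conv_radius (h - fps_X)"
    unfolding g_def
    by (auto intro!: h_rad less_le_trans [OF _ fps_conv_radius_add] less_le_trans [OF _ fps_conv_radius_diff])
  have h: "eval_fps h x = (1 - x) * mahler_fun s x"
    unfolding h_def mahler_fun_def
    by (subst eval_fps_mult) (use rad in \<open>auto intro!: less_le_trans [OF _ fps_conv_radius_diff] simp: eval_fps_diff\<close>)
  have "eval_fps g x = (1 - x) * mahler_fun s x - x + x\<^sup>2"
    unfolding g_def h [symmetric]
    by (subst eval_fps_add; (intro g_rad)?) (use g_rad in \<open>auto simp: eval_fps_diff h_rad\<close>)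
  moreover have g: "g = fps_const (of_int s) * fps_dilate2 (mahler_fps s)"
    unfolding g_def h_def by (subst mahler_fps_eq) simp
  have "(\<lambda>n. s * (fps_dilate2 (mahler_fps s) $ n * x ^ n)) sums eval_fps g x"
    using sums_eval_fps [of x g] g_rad(1) by (simp add: g mult.assoc)
  moreover have "(\<lambda>n. fps_dilate2 (mahler_fps s) $ n * x ^ n) sums mahler_fun s (x\<^sup>2)"
  proof -
    have "\<bar>x\<^sup>2\<bar> < 1" using x by (simp add: power_less_one_iff abs_square_less_1)
    then have "(\<lambda>n. fps_dilate2 (mahler_fps s) $ (2 * n) * x ^ (2 * n)) sums mahler_fun s (x\<^sup>2)"
      using mahler_fun_sums [OF s] by (simp add: power_mult)
    then show ?thesis
      by (subst (asm) sums_mono_reindex) (auto simp: strict_mono_def elim!: evenE)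
  qed
  then have "(\<lambda>n. s * (fps_dilate2 (mahler_fps s) $ n * x ^ n)) sums (s * mahler_fun s (x\<^sup>2))"
    by (rule sums_mult)
  ultimately have "(1 - x) * mahler_fun s x - x + x\<^sup>2 = s * mahler_fun s (x\<^sup>2)"
    by (metis sums_unique2)
  then show ?thesis by (simp add: algebra_simps power2_eq_square)
qed

lemma mahler_fun_iterate:
  assumes s: "\<bar>s\<bar> = 1" and x: "0 < x" "x < 1"
  shows "mahler_fun s x = (\<Sum>j<m. s ^ j * x ^ (2 ^ j) / (\<Prod>i<j. 1 - x ^ (2 ^ i)))
    + s ^ m * mahler_fun s (x ^ (2 ^ m)) / (\<Prod>i<m. 1 - x ^ (2 ^ i))"
proof (induction m)
  case (Suc m)
  have lt: "x ^ (2 ^ m) < 1" using x by (simp add: power_less_one_iff)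
  have "mahler_fun s (x ^ (2 ^ m)) = x ^ (2 ^ m) + s * mahler_fun s (x ^ (2 ^ Suc m)) / (1 - x ^ (2 ^ m))"
    using mahler_fun_eq [OF s, of "x ^ (2 ^ m)"] x lt
    by (simp add: field_simps power_mult [symmetric] mult.commute)
  then show ?case by (subst Suc) (simp add: add_divide_distrib distrib_left mult_ac)
qed simp

text \<open>Dividing by the leading power leaves a series that is continuous at 0 with nonzero value
  there, so near 0 the function is comparable to that power from both sides. The lower bound also
  certifies that values are nonzero.\<close>

lemma fps_order_bounds:
  fixes E :: "real fps"
  assumes E: "E \<noteq> 0" "fps_conv_radius E > 0"
  obtains C where "C > 0"
    "\<forall>\<^sub>F x in at_right 0. x ^ subdegree E / C \<le> \<bar>eval_fps E x\<bar> \<and> \<bar>eval_fps E x\<bar> \<le> C * x ^ subdegree E"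
proof -
  define d where "d = subdegree E"
  define c where "c = \<bar>E $ d\<bar>"
  have c: "c > 0" using E by (simp add: c_def d_def)
  have "ereal (norm (0::real)) < fps_conv_radius (fps_shift d E)"
    using E(2) by (metis fps_conv_radius_shift norm_zero zero_ereal_def)
  then have "continuous (at 0) (eval_fps (fps_shift d E))"
    by (rule continuous_eval_fps)
  then have "eval_fps (fps_shift d E) \<midarrow>0\<rightarrow> E $ d"
    by (simp add: isCont_def eval_fps_at_0)
  then have lim: "((\<lambda>x. \<bar>eval_fps (fps_shift d E) x\<bar>) \<longlongrightarrow> c) (at_right 0)"
    unfolding c_def by (rule tendsto_rabs [OF Lim_at_imp_Lim_at_within])
  have "\<forall>\<^sub>F x in at_right 0. c / 2 < \<bar>eval_fps (fps_shift d E) x\<bar> \<and> \<bar>eval_fps (fps_shift d E) x\<bar> < 2 * c"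
    using c by (intro eventually_conj order_tendstoD [OF lim]) auto
  moreover have "\<forall>\<^sub>F x::real in at_right 0. ereal (norm x) < fps_conv_radius E"
  proof -
    obtain e where e: "0 < ereal e" "ereal e < fps_conv_radius E" using ereal_dense2 [OF E(2)] by blast
    have "0 < e" using e(1) by simp
    from eventually_at_right_real [OF this] show ?thesis
    proof eventually_elim
      case (elim x)
      then have "ereal (norm x) < ereal e" by simp
      also note e(2)
      finally show "ereal (norm x) < fps_conv_radius E" .
    qed
  qed
  moreover have "\<forall>\<^sub>F x::real in at_right 0. x > 0" by (simp add: eventually_at_right_less)
  \<comment> \<open>The sum \<open>2 * c + 2 / c\<close> dominates both the constant
    \<open>2 * c\<close> of the upper bound and the reciprocal \<open>2 / c\<close> of the constant
    in the lower one.\<close>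
  ultimately have "\<forall>\<^sub>F x in at_right 0. x ^ d / (2 * c + 2 / c) \<le> \<bar>eval_fps E x\<bar> \<and>
      \<bar>eval_fps E x\<bar> \<le> (2 * c + 2 / c) * x ^ d"
  proof eventually_elim
    case (elim x)
    have "eval_fps (fps_shift d E) x = eval_fps E x / x ^ d"
      using elim by (subst eval_fps_shift) (auto simp: d_def)
    then have eq: "\<bar>eval_fps E x\<bar> = \<bar>eval_fps (fps_shift d E) x\<bar> * x ^ d"
      using elim by simp
    have "x ^ d / (2 * c + 2 / c) \<le> x ^ d / (2 / c)"
      using elim c by (intro divide_left_mono mult_pos_pos add_pos_pos) auto
    also have "\<dots> = (c / 2) * x ^ d" by simp
    also have "\<dots> \<le> \<bar>eval_fps E x\<bar>" unfolding eq using elim by (intro mult_right_mono) auto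
    finally have "x ^ d / (2 * c + 2 / c) \<le> \<bar>eval_fps E x\<bar>" .
    moreover have "2 / c > 0" using c by simp
    then have "\<bar>eval_fps (fps_shift d E) x\<bar> \<le> 2 * c + 2 / c"
      using elim by linarith
    then have "\<bar>eval_fps E x\<bar> \<le> (2 * c + 2 / c) * x ^ d"
      unfolding eq using elim by (intro mult_right_mono) auto
    ultimately show ?case ..
  qed
  then show ?thesis using c by (intro that [of "2 * c + 2 / c"]) (simp_all add: d_def add_pos_pos)
qed

lemma subdegree_mahler_fps: "subdegree (mahler_fps s :: real fps) = 1"
  by (rule subdegreeI) (auto simp: mahler_coeff.simps)

lemma filterlim_power_2_power_at_right_0:
  fixes x :: real
  assumes "0 < x" "x < 1"
  shows "filterlim (\<lambda>m. x ^ 2 ^ m) (at_right 0) sequentially"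
proof -
  have "strict_mono (\<lambda>m. 2 ^ m :: nat)" by (simp add: strict_mono_def)
  moreover have "(\<lambda>n. x ^ n) \<longlonglongrightarrow> 0" using assms by (intro LIMSEQ_power_zero) auto
  ultimately have "(\<lambda>m. x ^ 2 ^ m) \<longlonglongrightarrow> 0" using LIMSEQ_subseq_LIMSEQ by (fastforce simp: o_def)
  then show ?thesis using assms by (auto simp: filterlim_at)
qed

text \<open>The iterated functional equation has the partial sums of the series as main term. Its
  last term tends to 0: the numerator is of order \<open>x ^ 2 ^ m\<close>, while every factor of
  the product is at least 1/2, so that the division costs at most \<open>2 ^ m\<close>.\<close>

lemma mahler_fun_suminf:
  assumes s: "\<bar>s\<bar> = 1" and x: "0 < x" "x \<le> 1/2"
  shows "mahler_fun s x = (\<Sum>j. s ^ j * x ^ (2 ^ j) / (\<Prod>i<j. 1 - x ^ (2 ^ i)))"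
proof -
  let ?P = "\<lambda>m. \<Prod>i<m. 1 - x ^ (2 ^ i)"
  have "(mahler_fps s :: real fps) \<noteq> 0"
    using subdegree_mahler_fps [of s] by auto
  moreover have "fps_conv_radius (mahler_fps s :: real fps) > 0"
    using conv_radius_mahler_fps [OF s] by (auto intro: less_le_trans [of 0 1])
  ultimately obtain C where C: "C > 0" "\<forall>\<^sub>F x in at_right 0. \<bar>mahler_fun s x\<bar> \<le> C * x"
  proof (rule fps_order_bounds)
    fix C :: real assume C: "C > 0" and *: "\<forall>\<^sub>F x in at_right 0.
      x ^ subdegree (mahler_fps s :: real fps) / C \<le> \<bar>eval_fps (mahler_fps s) x\<bar> \<and>
      \<bar>eval_fps (mahler_fps s) x\<bar> \<le> C * x ^ subdegree (mahler_fps s :: real fps)"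
    from C show thesis
      by (rule that) (use * in eventually_elim, simp add: subdegree_mahler_fps mahler_fun_def)
  qed
  have "\<forall>\<^sub>F m in sequentially. \<bar>mahler_fun s (x ^ 2 ^ m)\<bar> \<le> C * x ^ 2 ^ m"
    using filterlim_power_2_power_at_right_0 [of x] C(2) x by (auto simp: filterlim_iff)
  then have bound: "\<forall>\<^sub>F m in sequentially. norm (s ^ m * mahler_fun s (x ^ 2 ^ m) / ?P m) \<le> C * (real (2 ^ m) * x ^ 2 ^ m)"
  proof eventually_elim
    case (elim m)
    have "x ^ 2 ^ i \<le> 1/2" for i
      using power_decreasing [of 1 "2 ^ i" x] x by simp
    then have "(\<Prod>i<m. 1/2) \<le> ?P m" by (intro prod_mono) (auto simp: field_simps)
    then have P: "1 / 2 ^ m \<le> ?P m" by (simp add: power_one_over)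
    have "norm (s ^ m * mahler_fun s (x ^ 2 ^ m) / ?P m) = \<bar>mahler_fun s (x ^ 2 ^ m)\<bar> / \<bar>?P m\<bar>"
      using s by (simp add: abs_mult power_abs flip: of_int_abs)
    also have "\<dots> \<le> (C * x ^ 2 ^ m) / (1 / 2 ^ m)"
      using elim P by (intro frac_le) auto
    finally show ?case by (simp add: mult_ac)
  qed
  have "strict_mono (\<lambda>m. 2 ^ m :: nat)" by (simp add: strict_mono_def)
  moreover have "(\<lambda>n. real n * x ^ n) \<longlonglongrightarrow> 0" using x by (intro powser_times_n_limit_0) auto
  ultimately have "(\<lambda>m. real (2 ^ m) * x ^ 2 ^ m) \<longlonglongrightarrow> 0"
    using LIMSEQ_subseq_LIMSEQ by (fastforce simp: o_def)
  then have "(\<lambda>m. C * (real (2 ^ m) * x ^ 2 ^ m)) \<longlonglongrightarrow> C * 0" by (rule tendsto_mult_left)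
  then have "(\<lambda>m. s ^ m * mahler_fun s (x ^ 2 ^ m) / ?P m) \<longlonglongrightarrow> 0"
    using Lim_null_comparison [OF bound] by simp
  then have "(\<lambda>m. mahler_fun s x - s ^ m * mahler_fun s (x ^ 2 ^ m) / ?P m) \<longlonglongrightarrow> mahler_fun s x - 0"
    by (intro tendsto_diff tendsto_const)
  moreover have "mahler_fun s x - s ^ m * mahler_fun s (x ^ 2 ^ m) / ?P m = (\<Sum>j<m. s ^ j * x ^ (2 ^ j) / ?P j)" for m
    using mahler_fun_iterate [OF s, of x m] x by simp
  ultimately have "(\<lambda>j. s ^ j * x ^ (2 ^ j) / ?P j) sums mahler_fun s x"
    by (simp add: sums_def)
  then show ?thesis by (simp add: sums_iff)
qed

text \<open>For \<open>B = b ^ 2 ^ m\<close> the functional equation at \<open>1 / B\<close> reads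
  \<open>B^2 f(1/B^2) = s (B - 1) (B f(1/B) - 1)\<close>. Thus \<open>B f(1/B)\<close> is the right
  quantity to follow: it stays an integer linear form in 1 and \<open>f(1/b)\<close>, and passing to
  the next level multiplies it by a factor below \<open>B\<close>.\<close>

lemma mahler_fun_inverse_power:
  fixes b :: int
  assumes s: "\<bar>s\<bar> = 1" and b: "b \<ge> 2"
  shows "\<exists>u w :: int. \<bar>u\<bar> \<le> b ^ 2 ^ m \<and> \<bar>w\<bar> \<le> b ^ 2 ^ m - 1 \<and>
    b ^ 2 ^ m * mahler_fun s (1 / b ^ 2 ^ m) = u * mahler_fun s (1 / b) - w"
proof (induction m)
  case 0
  show ?case by (intro exI [of _ b] exI [of _ 0]) (use b in auto)
next
  case (Suc m)
  define B where "B = b ^ 2 ^ m"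
  define G where "G = mahler_fun s (1 / B)"
  have B: "B \<ge> 2" using b self_le_power [of b "2 ^ m"] by (simp add: B_def)
  have B2: "b ^ 2 ^ Suc m = B * B" by (simp add: B_def power_add [symmetric] mult_2)
  from Suc obtain u w :: int where u: "\<bar>u\<bar> \<le> B" and w: "\<bar>w\<bar> \<le> B - 1"
    and eq: "B * G = u * mahler_fun s (1 / b) - w" by (auto simp: B_def G_def)
  have "(1 - 1 / B) * G = (1 / B) * (1 - 1 / B) + s * mahler_fun s (1 / (B * B))"
    using mahler_fun_eq [OF s, of "1 / B"] B by (simp add: G_def power2_eq_square)
  then have "s * mahler_fun s (1 / (B * B)) = (1 - 1 / B) * (G - 1 / B)" by (simp add: algebra_simps)
  \<comment> \<open>Multiplying by \<open>s\<close> replaces division by \<open>s\<close>, as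
    \<open>s * s = 1\<close>.\<close>
  then have e1: "s * s * (B * B * mahler_fun s (1 / (B * B))) = s * (B * B * ((1 - 1 / B) * (G - 1 / B)))"
    by (simp add: mult_ac)
  have "s * s = 1" using s by (auto simp: abs_if split: if_splits)
  then have e2: "real_of_int s * real_of_int s = 1" by (metis of_int_1 of_int_mult)
  have "B * B * mahler_fun s (1 / (B * B)) = s * (B * B * ((1 - 1 / B) * (G - 1 / B)))"
    using e1 by (simp only: e2 mult_1 of_int_mult)
  also have "B * B * ((1 - 1 / B) * (G - 1 / B)) = (B - 1) * (B * G - 1)"
    using B by (simp add: field_simps)
  also have "B * G - 1 = u * mahler_fun s (1 / b) - w - 1" by (simp add: eq)
  finally have "B * B * mahler_fun s (1 / (B * B)) = s * ((B - 1) * (u * mahler_fun s (1 / b) - w - 1))" .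
  then have "b ^ 2 ^ Suc m * mahler_fun s (1 / b ^ 2 ^ Suc m)
      = (s * (B - 1) * u) * mahler_fun s (1 / b) - (s * (B - 1) * (w + 1))"
    unfolding of_int_power [symmetric] B2 by (simp add: algebra_simps)
  moreover have "\<bar>s * (B - 1) * u\<bar> \<le> B * B"
    using B u s by (simp add: abs_mult mult_mono)
  moreover have "\<bar>s * (B - 1) * (w + 1)\<bar> \<le> B * B - 1"
  proof -
    have "\<bar>s * (B - 1) * (w + 1)\<bar> = (B - 1) * \<bar>w + 1\<bar>" using B s by (simp add: abs_mult)
    also have "\<dots> \<le> (B - 1) * B" using B w by (intro mult_left_mono) auto
    also have "\<dots> \<le> B * B - 1" using B by (simp add: algebra_simps)
    finally show ?thesis .
  qed
  ultimately show ?case unfolding B2 by blast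
qed

section \<open>Rational approximations\<close>

lemma int_poly_inverse_scaled:
  fixes B :: int
  assumes "degree p \<le> n" "B \<noteq> 0"
  shows "B ^ n * poly (map_poly real_of_int p) (1 / B) = of_int (\<Sum>i\<le>n. coeff p i * B ^ (n - i))"
proof -
  have "B ^ n * (coeff p i * (1 / B) ^ i) = coeff p i * B ^ (n - i)" if "i \<le> n" for i
  proof -
    have "real_of_int B ^ n = B ^ (n - i) * B ^ i" using that by (simp flip: power_add)
    then show ?thesis using assms(2) by (simp add: power_one_over)
  qed
  then show ?thesis
    unfolding poly_of_int_altdef [OF assms(1)] sum_distrib_left of_int_sum
    by (intro sum.cong) simp_all
qed

text \<open>At \<open>x = 1 / B\<close> with \<open>B = b ^ 2 ^ m\<close>, the Pade remainder lies
  between constant multiples of \<open>x ^ (2 * n + 2)\<close> and \<open>x ^ (2 * n + 1)\<close>.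
  Scaling by \<open>B ^ (n + 1)\<close> yields an integer linear form in 1 and \<theta>:
  \<open>B ^ n\<close> clears the polynomials, and one more \<open>B\<close> turns
  \<open>f(x)\<close> into a form in \<theta>. What is left lies between multiples of
  \<open>B ^ -(n + 1)\<close> and \<open>B ^ -n\<close>.\<close>

lemma mahler_fun_pade_approx:
  fixes b :: int
  assumes s: "\<bar>s\<bar> = 1" and b: "b \<ge> 2"
  obtains C :: real where "C > 0" "\<forall>\<^sub>F m in sequentially. \<exists>(p::int) (q::int).
    \<bar>real_of_int q\<bar> \<le> C * (b ^ 2 ^ m) ^ (n + 1) \<and>
    \<bar>q * mahler_fun s (1 / b) - p\<bar> \<le> C / (b ^ 2 ^ m) ^ n \<and>
    1 / (C * (b ^ 2 ^ m) ^ (n + 1)) \<le> \<bar>q * mahler_fun s (1 / b) - p\<bar>"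
proof -
  define \<theta> where "\<theta> = mahler_fun s (1 / b)"
  have "odd s" using s by (auto simp: abs_if split: if_splits)
  then obtain P Q :: "int poly" where deg: "degree P \<le> n" "degree Q \<le> n"
    and sub: "subdegree (fps_of_poly Q * mahler_fps s - fps_of_poly P) \<in> {2*n+1..2*n+2}"
    by (rule mahler_fps_pade)
  define D where "D = fps_of_poly Q * mahler_fps s - fps_of_poly P"
  define E :: "real fps" where "E = fps_of_poly (map_poly of_int Q) * mahler_fps s - fps_of_poly (map_poly of_int P)"
  define d where "d = subdegree D"
  have d: "2 * n + 1 \<le> d" "d \<le> 2 * n + 2" using sub by (auto simp: d_def D_def)
  have E_nth: "E $ k = of_int (D $ k)" for k
    unfolding E_def D_def by (rule mahler_fps_approx_of_int)
  have "D \<noteq> 0" using d by (auto simp: d_def)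
  then have "subdegree E = d"
    by (intro subdegreeI) (auto simp: E_nth d_def nth_less_subdegree_zero)
  have "E \<noteq> 0" using \<open>subdegree E = d\<close> d by auto
  have rad: "ereal (norm x) < fps_conv_radius (fps_of_poly (map_poly real_of_int Q) * mahler_fps s)" if "\<bar>x\<bar> < 1" for x :: real
    using less_conv_radius_mahler_fps [OF s that]
    by (intro less_le_trans [OF _ fps_conv_radius_mult]) auto
  have radE: "ereal (norm x) < fps_conv_radius E" if "\<bar>x\<bar> < 1" for x :: real
    unfolding E_def using rad [OF that]
    by (intro less_le_trans [OF _ fps_conv_radius_diff]) auto
  have eval: "eval_fps E x = poly (map_poly of_int Q) x * mahler_fun s x - poly (map_poly of_int P) x" if "\<bar>x\<bar> < 1" for x
    unfolding E_def mahler_fun_def using rad [OF that] less_conv_radius_mahler_fps [OF s that]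
    by (simp add: eval_fps_diff eval_fps_mult)
  have "fps_conv_radius E > 0" using radE [of 0] by (metis abs_zero norm_zero zero_ereal_def zero_less_one)
  with \<open>E \<noteq> 0\<close> obtain C0 where C0: "C0 > 0"
    "\<forall>\<^sub>F x in at_right 0. x ^ d / C0 \<le> \<bar>eval_fps E x\<bar> \<and> \<bar>eval_fps E x\<bar> \<le> C0 * x ^ d"
    by (rule fps_order_bounds [of E, unfolded \<open>subdegree E = d\<close>])
  define cQ where "cQ = (\<Sum>i\<le>n. \<bar>real_of_int (coeff Q i)\<bar>)"
  define C where "C = C0 + cQ"
  have cQ: "cQ \<ge> 0" by (simp add: cQ_def sum_nonneg)
  have C: "C > 0" using C0 cQ by (simp add: C_def)
  have "filterlim (\<lambda>m. (1 / real_of_int b) ^ 2 ^ m) (at_right 0) sequentially"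
    using b by (intro filterlim_power_2_power_at_right_0) auto
  from eventually_compose_filterlim [OF C0(2) this]
  have "\<forall>\<^sub>F m in sequentially. \<exists>(p::int) (q::int).
    \<bar>real_of_int q\<bar> \<le> C * (b ^ 2 ^ m) ^ (n + 1) \<and> \<bar>q * \<theta> - p\<bar> \<le> C / (b ^ 2 ^ m) ^ n \<and>
    1 / (C * (b ^ 2 ^ m) ^ (n + 1)) \<le> \<bar>q * \<theta> - p\<bar>"
  proof eventually_elim
    case (elim m)
    define B where "B = b ^ 2 ^ m"
    define x where "x = 1 / real_of_int B"
    have B: "B \<ge> 2" using b self_le_power [of b "2 ^ m"] by (simp add: B_def)
    have "(1 / real_of_int b) ^ 2 ^ m = x" by (simp add: x_def B_def power_one_over)
    with elim have ineq: "x ^ d / C0 \<le> \<bar>eval_fps E x\<bar>" "\<bar>eval_fps E x\<bar> \<le> C0 * x ^ d"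
      by simp_all
    have x: "0 < x" "x < 1" using B by (auto simp: x_def)
    obtain u w :: int where u: "\<bar>u\<bar> \<le> B" and uw: "B * mahler_fun s x = u * \<theta> - w"
      using mahler_fun_inverse_power [OF s b, of m] by (auto simp: B_def x_def \<theta>_def)
    define Qh Ph where "Qh = (\<Sum>i\<le>n. coeff Q i * B ^ (n - i))" and "Ph = (\<Sum>i\<le>n. coeff P i * B ^ (n - i))"
    have Qh: "B ^ n * poly (map_poly of_int Q) x = real_of_int Qh"
      and Ph: "B ^ n * poly (map_poly of_int P) x = real_of_int Ph"
      using int_poly_inverse_scaled [OF deg(2), of B] int_poly_inverse_scaled [OF deg(1), of B] B
      by (simp_all add: Qh_def Ph_def x_def)
    \<comment> \<open>The coefficients obtained by expanding
      \<open>B ^ (n + 1) * (Q(x) f(x) - P(x))\<close> with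
      \<open>B f(x) = u * \<theta> - w\<close>.\<close>
    define q p where "q = Qh * u" and "p = Qh * w + B * Ph"
    have "q * \<theta> - p = Qh * (u * \<theta> - w) - B * Ph" by (simp add: q_def p_def algebra_simps)
    also have "\<dots> = (B ^ n * poly (map_poly of_int Q) x) * (B * mahler_fun s x) - B * (B ^ n * poly (map_poly of_int P) x)"
      by (simp only: Qh Ph uw of_int_mult)
    also have "\<dots> = B ^ (n + 1) * eval_fps E x"
      using x by (simp add: eval algebra_simps)
    finally have "\<bar>q * \<theta> - p\<bar> = \<bar>B ^ (n + 1) * eval_fps E x\<bar>" by simp
    then have eq: "\<bar>q * \<theta> - p\<bar> = B ^ (n + 1) * \<bar>eval_fps E x\<bar>"
      using B by (simp add: abs_mult)
    have Bx: "real_of_int B * x = 1" using B by (simp add: x_def)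
    have Bx_pow: "B ^ k * x ^ k = 1" for k
      using Bx by (simp add: power_mult_distrib [symmetric])
    have "\<bar>q * \<theta> - p\<bar> \<le> B ^ (n + 1) * (C0 * x ^ d)"
      unfolding eq using B ineq(2) by (intro mult_left_mono) auto
    also have "\<dots> \<le> B ^ (n + 1) * (C * x ^ (n + 1 + n))"
      using d x C C0 B cQ by (intro mult_left_mono mult_mono power_decreasing) (auto simp: C_def)
    also have "\<dots> = C * x ^ n * (B ^ (n + 1) * x ^ (n + 1))"
      by (simp only: power_add) (simp add: mult_ac)
    also have "\<dots> = C / B ^ n" unfolding Bx_pow by (simp add: x_def power_one_over)
    finally have upper: "\<bar>q * \<theta> - p\<bar> \<le> C / B ^ n" .
    have "1 / (C * B ^ (n + 1)) = x ^ (n + 1) / C"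
      by (simp add: x_def power_one_over)
    also have "\<dots> \<le> x ^ (n + 1) / C0"
      using C0 cQ x by (intro divide_left_mono) (auto simp: C_def)
    also have "\<dots> = B ^ (n + 1) * x ^ (n + 1) * (x ^ (n + 1) / C0)" unfolding Bx_pow by simp
    also have "\<dots> = B ^ (n + 1) * (x ^ (2 * n + 2) / C0)"
      by (simp add: power_add [symmetric] mult_2)
    also have "\<dots> \<le> B ^ (n + 1) * (x ^ d / C0)"
      using d x C0 B by (intro mult_left_mono divide_right_mono power_decreasing) auto
    also have "\<dots> \<le> \<bar>q * \<theta> - p\<bar>"
      unfolding eq using B ineq(1) by (intro mult_left_mono) auto
    finally have lower: "1 / (C * B ^ (n + 1)) \<le> \<bar>q * \<theta> - p\<bar>" .
    have "\<bar>real_of_int Qh\<bar> \<le> (\<Sum>i\<le>n. \<bar>real_of_int (coeff Q i) * B ^ (n - i)\<bar>)"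
      unfolding Qh_def of_int_sum by (rule order_trans [OF sum_abs]) simp
    also have "\<dots> \<le> (\<Sum>i\<le>n. \<bar>real_of_int (coeff Q i)\<bar> * B ^ n)"
      unfolding abs_mult using B by (intro sum_mono mult_left_mono) (auto intro: power_increasing)
    also have "\<dots> = cQ * B ^ n" by (simp add: cQ_def sum_distrib_right)
    finally have "\<bar>real_of_int Qh\<bar> * \<bar>real_of_int u\<bar> \<le> (cQ * B ^ n) * B"
      using u B cQ by (intro mult_mono) auto
    also have "\<dots> = cQ * B ^ (n + 1)" by simp
    also have "\<dots> \<le> C * B ^ (n + 1)" using C0 B by (intro mult_right_mono) (auto simp: C_def)
    finally have "\<bar>real_of_int q\<bar> \<le> C * B ^ (n + 1)" by (simp add: q_def abs_mult)
    with upper lower show ?case unfolding B_def of_int_power by blast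
  qed
  then show ?thesis using that C by (simp add: \<theta>_def)
qed

section \<open>Choice of level and degree, and the upper bound for the exponent\<close>

lemma exists_power_between:
  fixes b y :: real
  assumes "b > 1" "y \<ge> 1"
  obtains t where "y \<le> b ^ t" "b ^ t \<le> b * y"
proof (cases "y \<le> b ^ 0")
  case True
  then show ?thesis using assms by (intro that [of 0]) (auto intro: order_trans [of _ "b * 1"])
next
  case False
  moreover have "\<exists>t. y \<le> b ^ t" using real_arch_pow [OF assms(1), of y] less_imp_le by blast
  ultimately obtain t where "\<not> y \<le> b ^ t" "y \<le> b ^ Suc t"
    using exists_least_lemma [of "\<lambda>t. y \<le> b ^ t"] by blast
  then show ?thesis using assms by (intro that [of "Suc t"]) auto
qed

text \<open>Take the largest level with \<open>N * 2 ^ m \<le> t\<close>. Then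
  \<open>t / 2 ^ m\<close> lies between \<open>N\<close> and \<open>2 * N\<close>, and
  \<open>n\<close> is its ceiling. The rounding error is below \<open>2 ^ m\<close>, hence at most
  the fraction \<open>1 / N\<close> of \<open>t\<close>.\<close>

lemma exists_dyadic_multiple_between:
  assumes "N \<ge> 1" "N * 2 ^ M \<le> t"
  obtains m n :: nat where "m \<ge> M" "n \<in> {N..2*N}" "N * 2 ^ m \<le> t" "t \<le> 2 ^ m * n" "2 ^ m * n \<le> t + 2 ^ m"
proof -
  have "\<exists>k. t < N * 2 ^ (M + k)"
    using assms(1) by (intro exI [of _ t]) (auto intro!: less_le_trans [OF less_exp] order_trans [OF power_increasing [of t "M + t"]])
  moreover have "\<not> t < N * 2 ^ (M + 0)" using assms by simp
  ultimately obtain k where k: "\<not> t < N * 2 ^ (M + k)" "t < N * 2 ^ (M + Suc k)"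
    using exists_least_lemma [of "\<lambda>k. t < N * 2 ^ (M + k)"] by blast
  define m where "m = M + k"
  define n where "n = (t + 2 ^ m - 1) div 2 ^ m"
  have t: "N * 2 ^ m \<le> t" "t < 2 * N * 2 ^ m" using k by (auto simp: m_def mult_ac)
  have up: "2 ^ m * n \<le> t + 2 ^ m - 1" by (simp add: n_def)
  have lo: "t + 2 ^ m - 1 < 2 ^ m * n + 2 ^ m"
  proof -
    have "2 ^ m * n + (t + 2 ^ m - 1) mod 2 ^ m = t + 2 ^ m - 1" unfolding n_def by (rule mult_div_mod_eq)
    moreover have "(t + 2 ^ m - 1) mod 2 ^ m < 2 ^ m" by simp
    ultimately show ?thesis by linarith
  qed
  have tn: "t \<le> 2 ^ m * n" using lo by linarith
  have "2 ^ m * N \<le> 2 ^ m * n" using t(1) tn mult.commute [of N "2 ^ m"] by linarith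
  then have "N \<le> n" by (simp only: nat_mult_le_cancel1 zero_less_power zero_less_numeral)
  moreover have "2 ^ m * n < 2 ^ m * (2 * N + 1)" using up t by (simp add: algebra_simps)
  then have "n < 2 * N + 1" by (simp only: nat_mult_less_cancel1 zero_less_power zero_less_numeral)
  ultimately show ?thesis
    using t tn up by (intro that [of m n]) (auto simp: m_def)
qed

lemma irrationality_exponent_mahler_fun_le_2:
  fixes b :: int
  assumes s: "\<bar>s\<bar> = 1" and b: "b \<ge> 2"
  shows "irrationality_exponent (mahler_fun s (1 / b)) \<le> 2"
proof (rule irrationality_exponent_le_2)
  fix \<kappa> :: real assume \<kappa>: "\<kappa> > 1"
  define \<theta> where "\<theta> = mahler_fun s (1 / b)"
  obtain N :: nat where N: "N > 2 / (\<kappa> - 1)" using reals_Archimedean2 by blast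
  then have "N > 0" using \<kappa> by (intro gr0I) (auto simp: field_simps)
  then have "N \<ge> 1" by simp
  \<comment> \<open>Two losses, each at most \<open>t / N\<close> in the exponent of
    \<open>b\<close>: rounding \<open>t\<close> up to \<open>2 ^ m * n\<close>, and the extra
    \<open>2 ^ m\<close> from \<open>n + 1\<close> in the bound for \<open>q\<close>. The remaining
    room between \<tau> and \<kappa> absorbs the constants.\<close>
  define \<tau> where "\<tau> = 1 + 2 / real N"
  have \<tau>: "\<tau> > 1" "\<tau> < \<kappa>" using N \<open>N > 0\<close> \<kappa> by (auto simp: \<tau>_def field_simps)
  define R where "R C n m \<longleftrightarrow> (\<exists>(p::int) (q::int).
    \<bar>real_of_int q\<bar> \<le> C * (b ^ 2 ^ m) ^ (n + 1) \<and> \<bar>q * \<theta> - p\<bar> \<le> C / (b ^ 2 ^ m) ^ n \<and>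
    1 / (C * (b ^ 2 ^ m) ^ (n + 1)) \<le> \<bar>q * \<theta> - p\<bar>)" for C :: real and n m
  have "\<exists>C>0. \<forall>\<^sub>F m in sequentially. R C n m" for n
    unfolding R_def \<theta>_def by (rule mahler_fun_pade_approx [OF s b, of n]) (rule exI, rule conjI)
  then obtain c where c: "\<And>n. c n > 0" "\<And>n. \<forall>\<^sub>F m in sequentially. R (c n) n m" by metis
  \<comment> \<open>Only degrees up to \<open>2 * N\<close> occur, so finitely many constants merge
    into one, and likewise one threshold \<open>M\<close> serves for all of them.\<close>
  define C where "C = (\<Sum>n\<le>2*N. c n)"
  have cC: "c n \<le> C" if "n \<le> 2 * N" for n
    unfolding C_def using that c(1) by (intro member_le_sum) (auto intro: less_imp_le)
  have C: "C > 0" using c(1) [of 0] cC [of 0] by simp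
  have mono: "R C n m" if "R (c n) n m" "n \<le> 2 * N" for n m
  proof -
    let ?B = "real_of_int b ^ 2 ^ m"
    have B: "?B > 0" using b by simp
    have "c n * ?B ^ (n + 1) \<le> C * ?B ^ (n + 1)" "c n / ?B ^ n \<le> C / ?B ^ n"
      using cC [OF that(2)] B by (auto intro!: mult_right_mono divide_right_mono)
    moreover from this(1) have "1 / (C * ?B ^ (n + 1)) \<le> 1 / (c n * ?B ^ (n + 1))"
      using B c(1) [of n] C by (intro divide_left_mono mult_pos_pos) auto
    ultimately show ?thesis using that(1) unfolding R_def of_int_power by (meson order_trans)
  qed
  have "\<forall>\<^sub>F m in sequentially. \<forall>n\<in>{..2*N}. R C n m"
    using eventually_mono [OF c(2) mono] by (intro eventually_ball_finite) auto
  then obtain M where M: "\<And>m n. m \<ge> M \<Longrightarrow> n \<le> 2 * N \<Longrightarrow> R C n m"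
    unfolding eventually_sequentially by auto
  \<comment> \<open>This forces the exponent \<open>t\<close> chosen below to exceed
    \<open>N * 2 ^ M\<close>, so that the level \<open>m\<close> is at least
    \<open>M\<close>.\<close>
  have ev1: "\<forall>\<^sub>F v in sequentially. real v \<ge> (b ^ (N * 2 ^ M) + 1) / (2 * C)"
    using filterlim_real_sequentially unfolding filterlim_at_top by blast
  have "filterlim (\<lambda>v. real v powr (\<kappa> - \<tau>)) at_top sequentially"
    using \<tau> by real_asymp
  then have ev2: "\<forall>\<^sub>F v in sequentially. real v powr (\<kappa> - \<tau>) \<ge> C * (b * (2 * C)) powr \<tau>"
    by (simp add: filterlim_at_top)
  show "\<forall>\<^sub>F v in sequentially. \<exists>(p::int) (q::int). real v * \<bar>q * mahler_fun s (1 / b) - p\<bar> \<le> 1/2 \<and>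
    \<bar>real_of_int q\<bar> \<le> real v powr \<kappa> \<and> real v powr (- \<kappa>) \<le> \<bar>q * mahler_fun s (1 / b) - p\<bar>"
    using ev1 ev2 eventually_gt_at_top [of 0] unfolding \<theta>_def [symmetric]
  proof eventually_elim
    case (elim v)
    \<comment> \<open>Once the denominator power \<open>B ^ n\<close> reaches this value,
      \<open>v * (C / B ^ n)\<close> is at most 1/2.\<close>
    define y where "y = 2 * C * v"
    have y: "y \<ge> b ^ (N * 2 ^ M) + 1" using elim(1) C by (simp add: y_def field_simps)
    have b1: "real_of_int b > 1" using b by simp
    have "real_of_int b ^ (N * 2 ^ M) \<ge> 0" using b by simp
    then have "y \<ge> 1" using y by simp
    with b1 obtain t where t: "y \<le> real_of_int b ^ t" "real_of_int b ^ t \<le> b * y"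
      by (rule exists_power_between)
    have "real_of_int b ^ (N * 2 ^ M) < real_of_int b ^ t" using y t by simp
    then have "N * 2 ^ M < t" using b1 by (rule power_less_imp_less_exp [rotated])
    then have "N * 2 ^ M \<le> t" by simp
    then obtain m n where m: "m \<ge> M" and n: "n \<in> {N..2*N}" and mn: "N * 2 ^ m \<le> t" "t \<le> 2 ^ m * n" "2 ^ m * n \<le> t + 2 ^ m"
      by (rule exists_dyadic_multiple_between [OF \<open>N \<ge> 1\<close>])
    let ?B = "real_of_int b ^ 2 ^ m"
    have "R C n m" using M m n by simp
    then obtain p q :: int where q: "\<bar>real_of_int q\<bar> \<le> C * ?B ^ (n + 1)"
      and pq: "\<bar>q * \<theta> - p\<bar> \<le> C / ?B ^ n" "1 / (C * ?B ^ (n + 1)) \<le> \<bar>q * \<theta> - p\<bar>"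
      unfolding R_def of_int_power by blast
    have "y \<le> real_of_int b ^ t" by fact
    also have "\<dots> \<le> real_of_int b ^ (2 ^ m * n)" using mn b by (intro power_increasing) auto
    also have "\<dots> = ?B ^ n" by (simp add: power_mult)
    finally have yB: "2 * C * v \<le> ?B ^ n" by (simp add: y_def)
    have "?B ^ (n + 1) = real_of_int b ^ (2 ^ m * (n + 1))" by (rule power_mult [symmetric])
    also have "\<dots> = real_of_int b powr real (2 ^ m * (n + 1))"
      using b by (subst powr_realpow) auto
    also have "\<dots> \<le> real_of_int b powr (t * \<tau>)"
    proof (rule powr_mono)
      have "2 ^ m * (n + 1) \<le> t + 2 * 2 ^ m" using mn by simp
      then have "real (2 ^ m * (n + 1)) \<le> real (t + 2 * 2 ^ m)" by (simp only: of_nat_le_iff)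
      also have "real (N * 2 ^ m) \<le> real t" using mn(1) by (simp only: of_nat_le_iff)
      then have "2 * 2 ^ m \<le> 2 * t / N" using \<open>N > 0\<close> by (simp add: field_simps)
      then have "real (t + 2 * 2 ^ m) \<le> t * \<tau>" by (simp add: \<tau>_def algebra_simps)
      finally show "real (2 ^ m * (n + 1)) \<le> t * \<tau>" .
    qed (use b in simp)
    also have "\<dots> = (real_of_int b ^ t) powr \<tau>"
    proof -
      have "real_of_int b ^ t = real_of_int b powr t" using b by (subst powr_realpow) auto
      then show ?thesis by (simp only: powr_powr)
    qed
    also have "\<dots> \<le> (b * y) powr \<tau>" using t(2) b \<tau> by (intro powr_mono2) auto
    also have "\<dots> = (b * (2 * C)) powr \<tau> * v powr \<tau>"
    proof -
      have "b * y = (b * (2 * C)) * v" by (simp add: y_def)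
      then show ?thesis using C b by (simp only:) (rule powr_mult; simp)
    qed
    finally have "C * ?B ^ (n + 1) \<le> C * (b * (2 * C)) powr \<tau> * v powr \<tau>"
      using C by (simp add: mult.assoc)
    also have "\<dots> \<le> real v powr (\<kappa> - \<tau>) * v powr \<tau>" using elim(2) by (intro mult_right_mono) auto
    also have "\<dots> = v powr \<kappa>" by (simp add: powr_add [symmetric])
    finally have CB: "C * ?B ^ (n + 1) \<le> v powr \<kappa>" .
    have pos: "?B > 0" using b by simp
    have "real v * \<bar>q * \<theta> - p\<bar> \<le> v * (C / ?B ^ n)" using pq(1) by (intro mult_left_mono) auto
    also have "\<dots> \<le> 1/2" using yB pos by (simp add: field_simps)
    finally have "real v * \<bar>q * \<theta> - p\<bar> \<le> 1/2" .
    moreover have "\<bar>real_of_int q\<bar> \<le> real v powr \<kappa>" using q CB by simp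
    moreover have "real v powr (- \<kappa>) \<le> \<bar>q * \<theta> - p\<bar>"
    proof -
      have "real v powr (- \<kappa>) = 1 / v powr \<kappa>" by (simp add: powr_minus divide_inverse)
      also have "\<dots> \<le> 1 / (C * ?B ^ (n + 1))"
        using CB C pos elim(3) by (intro divide_left_mono mult_pos_pos) auto
      finally show ?thesis using pq(2) by simp
    qed
    ultimately show ?case by blast
  qed
qed

section \<open>Growth and functional transcendence\<close>

lemma mahler_coeff_1 [simp]: "mahler_coeff s (Suc 0) = 1"
  by (simp add: mahler_coeff.simps)

text \<open>Cruder than \<open>mahler_coeff_bound\<close>, but free of unspecified constants, as the
  numerical evaluation below requires.\<close>

lemma mahler_coeff_le_power_2:
  assumes "\<bar>s\<bar> = 1"
  shows "\<bar>mahler_coeff s n\<bar> \<le> 2 ^ n"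
proof (induction n rule: less_induct)
  case (less n)
  consider "n = 0" | "n = 1" | "n = 2" | "n \<ge> 3" by linarith
  then show ?case
  proof cases
    case 4
    define c where "c = (if even n then s * mahler_coeff s (n div 2) else 0)"
    have "\<bar>c\<bar> \<le> 2 ^ (n div 2)"
      using less [of "n div 2"] 4 assms by (auto simp: c_def abs_mult)
    also have "\<dots> \<le> 2 ^ (n - 1)" using 4 by (intro power_increasing) auto
    finally have "\<bar>c\<bar> \<le> 2 ^ (n - 1)" .
    moreover have "mahler_coeff s n = mahler_coeff s (n - 1) + c"
      using 4 by (subst mahler_coeff.simps) (auto simp: c_def)
    moreover have "\<bar>mahler_coeff s (n - 1)\<bar> \<le> 2 ^ (n - 1)" using less 4 by simp
    ultimately have "\<bar>mahler_coeff s n\<bar> \<le> 2 * 2 ^ (n - 1)" by linarith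
    also have "\<dots> = 2 ^ n" using 4 by (cases n) auto
    finally show ?thesis .
  qed (use assms in \<open>auto simp: mahler_coeff.simps [of _ 2]\<close>)
qed

lemma mahler_fun_le:
  assumes s: "\<bar>s\<bar> = 1" and x: "0 \<le> x" "x \<le> 1/4"
  shows "\<bar>mahler_fun s x\<bar> \<le> 4 * x"
proof -
  have "(\<lambda>n. real_of_int (mahler_coeff s n) * x ^ n) sums mahler_fun s x"
    using x by (intro mahler_fun_sums [OF s]) auto
  then have sums: "(\<lambda>n. real_of_int (mahler_coeff s (Suc n)) * x ^ Suc n) sums mahler_fun s x"
    using sums_Suc_iff [of "\<lambda>n. real_of_int (mahler_coeff s n) * x ^ n" "mahler_fun s x"] by simp
  have "(\<lambda>n. 2 * x * (1/2) ^ n) sums (2 * x * (1 / (1 - 1/2)))"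
    by (intro sums_mult geometric_sums) simp
  then have geo: "(\<lambda>n. 2 * x * (1/2) ^ n) sums (4 * x)" by simp
  have "norm (real_of_int (mahler_coeff s (Suc n)) * x ^ Suc n) \<le> 2 * x * (1/2) ^ n" for n
  proof -
    have "real_of_int \<bar>mahler_coeff s (Suc n)\<bar> \<le> real_of_int (2 ^ Suc n)"
      unfolding of_int_le_iff by (rule mahler_coeff_le_power_2 [OF s])
    then have "norm (real_of_int (mahler_coeff s (Suc n)) * x ^ Suc n) \<le> 2 ^ Suc n * x ^ Suc n"
      using x by (simp add: abs_mult mult_right_mono)
    also have "\<dots> = 2 * x * (2 * x) ^ n" by (simp add: power_mult_distrib)
    also have "\<dots> \<le> 2 * x * (1/2) ^ n" using x by (intro mult_left_mono power_mono) auto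
    finally show ?thesis .
  qed
  then have "norm (\<Sum>n. real_of_int (mahler_coeff s (Suc n)) * x ^ Suc n) \<le> (\<Sum>n. 2 * x * (1/2) ^ n)"
    using geo by (intro norm_suminf_le) (auto simp: sums_iff)
  then show ?thesis using sums geo by (simp add: sums_iff)
qed

text \<open>
  Once $|f|$ exceeds 2 near 1, the functional equation makes it explode along $x, \<surd>x, \<surd>\<surd>x, \<dots>$; for
  $s = -1$ such a starting point is found numerically.
\<close>

lemma mahler_fun_large_value:
  assumes "\<bar>s\<bar> = 1"
  shows "\<bar>mahler_fun s (11/12)\<bar> \<ge> 2"
proof -
  have step: "mahler_fun s ((11/12) ^ n) = (11/12) ^ n + s * mahler_fun s ((11/12) ^ (2 * n)) / (1 - (11/12) ^ n)"
    if "n > 0" for n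
  proof -
    define x :: real where "x = (11/12) ^ n"
    have x: "0 < x" "x < 1" using that by (simp_all add: x_def power_less_one_iff)
    have sq: "x\<^sup>2 = (11/12) ^ (2 * n)" unfolding x_def by (simp only: mult.commute power_mult)
    have "mahler_fun s x = x + s * mahler_fun s (x\<^sup>2) / (1 - x)"
      using mahler_fun_eq [OF assms, of x] x by (simp add: field_simps)
    then show ?thesis unfolding sq unfolding x_def .
  qed
  \<comment> \<open>Seven squarings bring the argument well below 1/4, where
    \<open>mahler_fun_le\<close> applies. Unwinding them divides \<open>g\<close> by a product of
    denominators larger than 1/1000, so \<open>g\<close> changes the value by less than 0.1; for
    \<open>s = -1\<close> that value is about 4.\<close>
  define g where "g = mahler_fun s ((11/12) ^ 128)"
  have "\<bar>g\<bar> \<le> 4 * (11/12) ^ 128"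
    unfolding g_def by (intro mahler_fun_le assms) (simp_all add: power_divide)
  also have "\<dots> \<le> 1 / 10000" by (simp add: power_divide)
  finally have g: "\<bar>g\<bar> \<le> 1 / 10000" .
  have eqs: "mahler_fun s (11/12) = 11/12 + s * mahler_fun s ((11/12) ^ 2) / (1 - 11/12)"
    "mahler_fun s ((11/12) ^ 2) = (11/12) ^ 2 + s * mahler_fun s ((11/12) ^ 4) / (1 - (11/12) ^ 2)"
    "mahler_fun s ((11/12) ^ 4) = (11/12) ^ 4 + s * mahler_fun s ((11/12) ^ 8) / (1 - (11/12) ^ 4)"
    "mahler_fun s ((11/12) ^ 8) = (11/12) ^ 8 + s * mahler_fun s ((11/12) ^ 16) / (1 - (11/12) ^ 8)"
    "mahler_fun s ((11/12) ^ 16) = (11/12) ^ 16 + s * mahler_fun s ((11/12) ^ 32) / (1 - (11/12) ^ 16)"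
    "mahler_fun s ((11/12) ^ 32) = (11/12) ^ 32 + s * mahler_fun s ((11/12) ^ 64) / (1 - (11/12) ^ 32)"
    "mahler_fun s ((11/12) ^ 64) = (11/12) ^ 64 + s * g / (1 - (11/12) ^ 64)"
    using step [of 1] step [of 2] step [of 4] step [of 8] step [of 16] step [of 32] step [of 64]
    by (simp_all only: g_def power_one_right mult_1_right zero_less_numeral zero_less_one simp_thms arith_simps)
  have "\<bar>s\<bar> = 1 \<Longrightarrow> s = 1 \<or> s = -1" by linarith
  with assms consider "s = 1" | "s = -1" by blast
  then show ?thesis
  proof cases
    case 1
    have "2 \<le> 11/12 + ((11/12) ^ 2 + ((11/12) ^ 4 + ((11/12) ^ 8 + ((11/12) ^ 16 + ((11/12) ^ 32 + ((11/12) ^ 64 + g / (1 - (11/12) ^ 64)) / (1 - (11/12) ^ 32)) / (1 - (11/12) ^ 16)) / (1 - (11/12) ^ 8)) / (1 - (11/12) ^ 4)) / (1 - (11/12) ^ 2)) / (1 - 11/12)"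
      using abs_le_D2 [OF g] by (simp add: power_divide field_simps)
    also have "\<dots> = mahler_fun s (11/12)"
      unfolding eqs unfolding 1 of_int_1 mult_1_left ..
    finally show ?thesis by linarith
  next
    case 2
    have "2 \<le> 11/12 - ((11/12) ^ 2 - ((11/12) ^ 4 - ((11/12) ^ 8 - ((11/12) ^ 16 - ((11/12) ^ 32 - ((11/12) ^ 64 - g / (1 - (11/12) ^ 64)) / (1 - (11/12) ^ 32)) / (1 - (11/12) ^ 16)) / (1 - (11/12) ^ 8)) / (1 - (11/12) ^ 4)) / (1 - (11/12) ^ 2)) / (1 - 11/12)"
      using abs_le_D1 [OF g] by (simp add: power_divide field_simps)
    also have "\<dots> = mahler_fun s (11/12)"
      unfolding eqs unfolding 2 of_int_minus of_int_1 mult_minus_left mult_1_left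
        minus_divide_left [symmetric] add_uminus_conv_diff ..
    finally show ?thesis by linarith
  qed
qed

text \<open>Passing from \<open>y\<close> to its square root divides the function by roughly
  \<open>1 - sqrt y\<close>, which tends to 0, whereas \<open>(1 - y) ^ k\<close> shrinks by at most
  \<open>2 ^ k\<close>. Hence \<open>h\<close> eventually at least doubles at each step.\<close>

lemma mahler_fun_not_polynomially_bounded:
  assumes s: "\<bar>s\<bar> = 1"
    and bound: "\<forall>\<^sub>F x in at_left 1. \<bar>mahler_fun s x\<bar> * (1 - x) ^ k \<le> K"
  shows False
proof -
  define y where "y n = (sqrt ^^ n) (11/12 :: real)" for n
  define h where "h n = \<bar>mahler_fun s (y n)\<bar> * (1 - y n) ^ k" for n
  have y: "11/12 \<le> y n \<and> y n < 1" for n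
  proof (induction n)
    case (Suc n)
    have "(11/12)\<^sup>2 \<le> y n" using Suc by (simp add: power2_eq_square)
    then have "11/12 \<le> sqrt (y n)" by (rule real_le_rsqrt)
    then show ?case using Suc by (simp add: y_def)
  qed (simp add: y_def)
  have y_Suc: "(y (Suc n))\<^sup>2 = y n" for n
    using y [of n] by (simp add: y_def)
  have e_Suc: "1 - y n = (1 - y (Suc n)) * (1 + y (Suc n))" for n
    unfolding y_Suc [of n, symmetric] by (simp add: power2_eq_square algebra_simps)
  have e_le: "1 - y (Suc n) \<le> (2/3) * (1 - y n)" for n
  proof -
    have "(3/2) * (1 - y (Suc n)) \<le> (1 - y (Suc n)) * (1 + y (Suc n))"
      using y [of "Suc n"] by (subst mult.commute) (intro mult_left_mono, auto)
    then show ?thesis using e_Suc [of n] by simp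
  qed
  have e_pow: "1 - y n \<le> (2/3) ^ n" for n
  proof (induction n)
    case 0
    then show ?case using y [of 0] by simp
  next
    case (Suc n)
    then show ?case using e_le [of n] by simp
  qed
  have e_lim: "(\<lambda>n. 1 - y n) \<longlonglongrightarrow> 0"
  proof (rule tendsto_sandwich [of "\<lambda>_. 0"])
    show "(\<lambda>n. (2/3::real) ^ n) \<longlonglongrightarrow> 0" by (intro LIMSEQ_power_zero) simp
  qed (use y e_pow in \<open>auto intro!: always_eventually less_imp_le\<close>)
  have rec: "\<bar>mahler_fun s (y (Suc n))\<bar> \<ge> \<bar>mahler_fun s (y n)\<bar> / (1 - y (Suc n)) - 1" for n
  proof -
    define x where "x = y (Suc n)"
    have x: "0 < x" "x < 1" using y [of "Suc n"] by (auto simp: x_def)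
    have "mahler_fun s x = x + s * mahler_fun s (y n) / (1 - x)"
      using mahler_fun_eq [OF s, of x] x by (simp add: x_def y_Suc field_simps)
    then have "s * mahler_fun s (y n) / (1 - x) = mahler_fun s x - x" by simp
    then have "\<bar>s * mahler_fun s (y n) / (1 - x)\<bar> \<le> \<bar>mahler_fun s x\<bar> + \<bar>x\<bar>"
      by (metis abs_triangle_ineq4)
    moreover have "\<bar>real_of_int s\<bar> = 1" using s by linarith
    ultimately show ?thesis using x by (simp add: abs_mult x_def)
  qed
  \<comment> \<open>A value of at least 2 divided by a number below 1 is at least 2, so the additive
    error 1 costs at most half of it. This is why the starting value must reach 2.\<close>
  have rec': "\<bar>mahler_fun s (y (Suc n))\<bar> \<ge> \<bar>mahler_fun s (y n)\<bar> / (2 * (1 - y (Suc n)))"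
    if "\<bar>mahler_fun s (y n)\<bar> \<ge> 2" for n
  proof -
    define e where "e = 1 - y (Suc n)"
    have "1 \<le> 1 / e" using y [of "Suc n"] by (simp add: e_def)
    then have "2 * 1 \<le> \<bar>mahler_fun s (y n)\<bar> * (1 / e)"
      using that by (intro mult_mono) auto
    then show ?thesis using rec [of n] unfolding e_def [symmetric] by simp
  qed
  have large: "\<bar>mahler_fun s (y n)\<bar> \<ge> 2" for n
  proof (induction n)
    case 0
    then show ?case using mahler_fun_large_value [OF s] by (simp add: y_def)
  next
    case (Suc n)
    have "2 \<le> \<bar>mahler_fun s (y n)\<bar> / 1" using Suc by simp
    also have "\<dots> \<le> \<bar>mahler_fun s (y n)\<bar> / (2 * (1 - y (Suc n)))"
      using y [of "Suc n"] by (intro divide_left_mono) auto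
    finally show ?case using rec' [OF Suc] by simp
  qed
  have h_pos: "h n > 0" for n using large [of n] y [of n] by (simp add: h_def)
  have h_Suc: "h n / (2 * 2 ^ k * (1 - y (Suc n))) \<le> h (Suc n)" for n
  proof -
    have "1 - y n \<le> 2 * (1 - y (Suc n))"
      unfolding e_Suc [of n] using y [of "Suc n"] by (subst mult.commute) (intro mult_right_mono, auto)
    then have "(1 - y n) ^ k \<le> (2 * (1 - y (Suc n))) ^ k"
      using y [of n] by (intro power_mono) auto
    then have "(1 - y n) ^ k / 2 ^ k \<le> (1 - y (Suc n)) ^ k"
      by (simp only: power_mult_distrib) (simp add: field_simps)
    then have "\<bar>mahler_fun s (y n)\<bar> / (2 * (1 - y (Suc n))) * ((1 - y n) ^ k / 2 ^ k) \<le> h (Suc n)"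
      unfolding h_def using rec' [OF large [of n]] y [of n] by (intro mult_mono) auto
    then show ?thesis by (simp only: h_def [of n] times_divide_times_eq mult_ac)
  qed
  have "\<forall>\<^sub>F n in sequentially. 1 - y n < 1 / (4 * 2 ^ k)"
    using e_lim by (rule order_tendstoD) simp
  then obtain n1 where n1: "\<And>n. n \<ge> n1 \<Longrightarrow> 1 - y n < 1 / (4 * 2 ^ k)"
    unfolding eventually_sequentially by blast
  have "y \<longlonglongrightarrow> 1" using tendsto_diff [OF tendsto_const [of 1] e_lim] by simp
  then have "filterlim y (at_left 1) sequentially"
    using y by (auto simp: filterlim_at less_imp_neq)
  then have "\<forall>\<^sub>F n in sequentially. h n \<le> K"
    unfolding h_def by (rule eventually_compose_filterlim [OF bound])
  then obtain n2 where n2: "\<And>n. n \<ge> n2 \<Longrightarrow> h n \<le> K"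
    unfolding eventually_sequentially by blast
  define n0 where "n0 = max n1 n2"
  \<comment> \<open>The threshold \<open>1 / (4 * 2 ^ k)\<close> for \<open>1 - y n\<close> is the
    one that pushes the divisor in \<open>h_Suc\<close> down to 1/2.\<close>
  have double: "2 * h n \<le> h (Suc n)" if "n \<ge> n0" for n
  proof -
    have "2 * 2 ^ k * (1 - y (Suc n)) \<le> 1/2"
      using n1 [of "Suc n"] that by (simp add: n0_def field_simps)
    then have "h n / (1/2) \<le> h n / (2 * 2 ^ k * (1 - y (Suc n)))"
      using h_pos [of n] y [of "Suc n"] by (intro divide_left_mono) auto
    then show ?thesis using h_Suc [of n] by simp
  qed
  have "2 ^ i * h n0 \<le> h (n0 + i)" for i
  proof (induction i)
    case (Suc i)
    then show ?case using double [of "n0 + i"] by simp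
  qed simp
  moreover obtain i where "K / h n0 < 2 ^ i" using real_arch_pow [of 2 "K / h n0"] by auto
  then have "K < 2 ^ i * h n0" using h_pos [of n0] by (simp add: field_simps)
  ultimately show False using n2 [of "n0 + i"] by (smt (verit) n0_def max.cobounded2 trans_le_add1)
qed

section \<open>Functional transcendence from growth at 1\<close>

lemma poly_lower_bound_at_left_1:
  fixes p :: "real poly"
  assumes "p \<noteq> 0"
  obtains c k where "c > 0" "\<forall>\<^sub>F x in at_left 1. c * (1 - x) ^ k \<le> \<bar>poly p x\<bar>"
proof -
  define k where "k = order 1 p"
  obtain q where q: "p = [:- 1, 1:] ^ k * q" "\<not> [:- 1, 1:] dvd q"
    using order_decomp [OF assms, of 1] by (auto simp: k_def)
  define c where "c = \<bar>poly q 1\<bar> / 2"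
  have c: "c > 0" using q(2) by (auto simp: c_def poly_eq_0_iff_dvd)
  have "((\<lambda>x. \<bar>poly q x\<bar>) \<longlongrightarrow> \<bar>poly q 1\<bar>) (at_left 1)"
    by (intro tendsto_intros)
  then have "\<forall>\<^sub>F x in at_left 1. c < \<bar>poly q x\<bar>"
    by (rule order_tendstoD) (use c in \<open>simp add: c_def\<close>)
  moreover have "\<forall>\<^sub>F x in at_left (1::real). x < 1" by (simp add: eventually_at_filter)
  ultimately have "\<forall>\<^sub>F x in at_left 1. c * (1 - x) ^ k \<le> \<bar>poly p x\<bar>"
  proof eventually_elim
    case (elim x)
    have "\<bar>poly p x\<bar> = \<bar>poly q x\<bar> * (1 - x) ^ k"
      using elim by (simp add: q(1) abs_mult power_abs)
    then show ?case using elim by (simp add: mult_right_mono)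
  qed
  with c show ?thesis by (rule that)
qed

lemma eval_fps_poly_mahler:
  fixes x :: real
  assumes s: "\<bar>s\<bar> = 1" and x: "\<bar>x\<bar> < 1"
  shows "ereal \<bar>x\<bar> < fps_conv_radius (\<Sum>j\<le>n. fps_of_poly (A j) * mahler_fps s ^ j)"
    and "eval_fps (\<Sum>j\<le>n. fps_of_poly (A j) * mahler_fps s ^ j) x = (\<Sum>j\<le>n. poly (A j) x * mahler_fun s x ^ j)"
proof -
  note rad = less_conv_radius_mahler_fps [OF s x, simplified]
  have radp: "ereal \<bar>x\<bar> < fps_conv_radius (mahler_fps s ^ j :: real fps)" for j
    by (rule less_le_trans [OF rad fps_conv_radius_power])
  have radm: "ereal \<bar>x\<bar> < fps_conv_radius (fps_of_poly (A j) * mahler_fps s ^ j)" for j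
    by (rule less_le_trans [OF _ fps_conv_radius_mult]) (simp add: radp)
  have "ereal \<bar>x\<bar> < fps_conv_radius (\<Sum>j\<le>n. fps_of_poly (A j) * mahler_fps s ^ j) \<and>
    eval_fps (\<Sum>j\<le>n. fps_of_poly (A j) * mahler_fps s ^ j) x = (\<Sum>j\<le>n. poly (A j) x * mahler_fun s x ^ j)"
  proof (induction n)
    case 0
    then show ?case by simp
  next
    case (Suc n)
    have "ereal \<bar>x\<bar> < fps_conv_radius (\<Sum>j\<le>Suc n. fps_of_poly (A j) * mahler_fps s ^ j)"
      unfolding sum.atMost_Suc using Suc radm [of "Suc n"]
      by (intro less_le_trans [OF _ fps_conv_radius_add]) simp
    moreover have "eval_fps (fps_of_poly (A (Suc n)) * mahler_fps s ^ Suc n) x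
        = poly (A (Suc n)) x * mahler_fun s x ^ Suc n"
      using radp [of "Suc n"] rad by (simp add: eval_fps_mult eval_fps_power mahler_fun_def del: power_Suc)
    ultimately show ?case using Suc radm [of "Suc n"] by (simp add: eval_fps_add del: power_Suc)
  qed
  then show "ereal \<bar>x\<bar> < fps_conv_radius (\<Sum>j\<le>n. fps_of_poly (A j) * mahler_fps s ^ j)"
    and "eval_fps (\<Sum>j\<le>n. fps_of_poly (A j) * mahler_fps s ^ j) x = (\<Sum>j\<le>n. poly (A j) x * mahler_fun s x ^ j)"
    by blast+
qed

text \<open>In a relation with top index \<open>d\<close>, solving for the top term gives
  \<open>|A_d| * |f| \<le> M\<close> wherever \<open>|f| > 1\<close>. Since \<open>A_d\<close>
  vanishes at 1 to finite order only, \<open>|f|\<close> would be bounded by a power of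
  \<open>1 / (1 - x)\<close>, against the growth just shown.\<close>

lemma mahler_fps_transcendental:
  fixes A :: "nat \<Rightarrow> real poly"
  assumes s: "\<bar>s\<bar> = 1" and zero: "(\<Sum>j\<le>N. fps_of_poly (A j) * mahler_fps s ^ j) = 0"
  shows "\<forall>j\<le>N. A j = 0"
proof (rule ccontr)
  assume "\<not> ?thesis"
  then have ne: "{j. j \<le> N \<and> A j \<noteq> 0} \<noteq> {}" by auto
  define d where "d = Max {j. j \<le> N \<and> A j \<noteq> 0}"
  have d: "d \<le> N" "A d \<noteq> 0" using Max_in [OF _ ne] by (auto simp: d_def)
  have d_max: "A j = 0" if "j \<le> N" "j > d" for j
  proof (rule ccontr)
    assume "A j \<noteq> 0"
    then have "j \<le> d" unfolding d_def using that by (intro Max_ge) auto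
    with that show False by simp
  qed
  have "(\<Sum>j\<le>d. poly (A j) x * mahler_fun s x ^ j) = 0" if x: "\<bar>x\<bar> < 1" for x
  proof -
    have "(\<Sum>j\<le>N. poly (A j) x * mahler_fun s x ^ j) = 0"
      using eval_fps_poly_mahler [OF s x, of A N] zero by simp
    also have "(\<Sum>j\<le>N. poly (A j) x * mahler_fun s x ^ j) = (\<Sum>j\<le>d. poly (A j) x * mahler_fun s x ^ j)"
      using d d_max by (intro sum.mono_neutral_right) auto
    finally show ?thesis .
  qed
  then have eq: "poly (A d) x * mahler_fun s x ^ d = - (\<Sum>j<d. poly (A j) x * mahler_fun s x ^ j)" if "\<bar>x\<bar> < 1" for x
    using that by (simp add: lessThan_Suc_atMost [symmetric] eq_neg_iff_add_eq_0 add.commute)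
  obtain c k where c: "c > 0" "\<forall>\<^sub>F x in at_left 1. c * (1 - x) ^ k \<le> \<bar>poly (A d) x\<bar>"
    using poly_lower_bound_at_left_1 [OF d(2)] by blast
  define M where "M = (\<Sum>j<d. \<bar>poly (A j) 1\<bar> + 1)"
  have "\<forall>\<^sub>F x in at_left 1. \<forall>j\<in>{..<d}. \<bar>poly (A j) x\<bar> < \<bar>poly (A j) 1\<bar> + 1"
  proof (intro eventually_ball_finite ballI finite_lessThan)
    fix j
    have "((\<lambda>x. \<bar>poly (A j) x\<bar>) \<longlongrightarrow> \<bar>poly (A j) 1\<bar>) (at_left 1)"
      by (intro tendsto_intros)
    then show "\<forall>\<^sub>F x in at_left 1. \<bar>poly (A j) x\<bar> < \<bar>poly (A j) 1\<bar> + 1"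
      by (rule order_tendstoD) simp
  qed
  moreover have "\<forall>\<^sub>F x in at_left (1::real). 0 < x \<and> x < 1"
    using eventually_at_left_real [of 0 1] by simp
  ultimately have "\<forall>\<^sub>F x in at_left 1. \<bar>mahler_fun s x\<bar> * (1 - x) ^ k \<le> 1 + M / c"
    using c(2)
  proof eventually_elim
    case (elim x)
    define g where "g = \<bar>mahler_fun s x\<bar>"
    have M: "M \<ge> 0" by (simp add: M_def sum_nonneg)
    have e: "0 < 1 - x" "(1 - x) ^ k \<le> 1" using elim by (auto intro: power_le_one)
    have "g * (1 - x) ^ k \<le> 1 + M / c"
    proof (cases "g \<le> 1")
      case True
      then have "g * (1 - x) ^ k \<le> 1" using e by (auto simp: g_def intro: mult_le_one)
      also have "\<dots> \<le> 1 + M / c" using M c by simp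
      finally show ?thesis .
    next
      case False
      have "d \<noteq> 0"
      proof
        assume "d = 0"
        then have "poly (A d) x = 0" using eq [of x] elim by simp
        then show False using elim(3) c(1) e(1) by (smt (verit) mult_pos_pos zero_less_power)
      qed
      then obtain d' where d': "d = Suc d'" using not0_implies_Suc by blast
      have "c * (1 - x) ^ k * g ^ d \<le> \<bar>poly (A d) x\<bar> * g ^ d"
        using elim by (intro mult_right_mono) (auto simp: g_def)
      also have "\<dots> = \<bar>\<Sum>j<d. poly (A j) x * mahler_fun s x ^ j\<bar>"
        using eq [of x] elim by (simp add: g_def power_abs [symmetric] abs_mult [symmetric])
      also have "\<dots> \<le> (\<Sum>j<d. \<bar>poly (A j) x * mahler_fun s x ^ j\<bar>)" by (rule sum_abs)
      also have "\<dots> \<le> (\<Sum>j<d. (\<bar>poly (A j) 1\<bar> + 1) * g ^ d')"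
      proof (rule sum_mono)
        fix j assume j: "j \<in> {..<d}"
        then have "g ^ j \<le> g ^ d'" using False d' by (intro power_increasing) auto
        then show "\<bar>poly (A j) x * mahler_fun s x ^ j\<bar> \<le> (\<bar>poly (A j) 1\<bar> + 1) * g ^ d'"
          using elim(1) j unfolding abs_mult power_abs g_def by (intro mult_mono) (auto intro: less_imp_le)
      qed
      also have "\<dots> = M * g ^ d'" by (simp add: M_def sum_distrib_right)
      finally have "c * (1 - x) ^ k * g * g ^ d' \<le> M * g ^ d'" by (simp add: d' mult_ac)
      then have "c * (1 - x) ^ k * g \<le> M" using False by simp
      then have "g * (1 - x) ^ k \<le> M / c" using c(1) by (simp add: field_simps)
      then show ?thesis by simp
    qed
    then show ?case by (simp add: g_def)
  qed
  then show False by (rule mahler_fun_not_polynomially_bounded [OF s])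
qed

section \<open>Mahler's method\<close>

lemma map_poly_of_int_sum:
  "map_poly real_of_int (\<Sum>a\<in>S. p a) = (\<Sum>a\<in>S. map_poly real_of_int (p a))"
  by (intro poly_eqI) (simp add: coeff_map_poly coeff_sum)

lemma map_poly_of_int_mult:
  "map_poly real_of_int (p * q) = map_poly real_of_int p * map_poly real_of_int q"
  by (intro poly_eqI) (simp add: coeff_map_poly coeff_mult)

lemma map_poly_of_int_linear_power:
  "map_poly real_of_int ([:w, u:] ^ j) = [:of_int w, of_int u:] ^ j"
  by (induction j) (simp_all add: map_poly_of_int_mult map_poly_pCons del: mult_pCons_left)

lemma coeff_linear_power_le:
  fixes u w :: int
  assumes "\<bar>u\<bar> \<le> B" "\<bar>w\<bar> \<le> B"
  shows "\<bar>coeff ([:w, u:] ^ j) i\<bar> \<le> (2 * B) ^ j"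
proof (induction j arbitrary: i)
  case 0
  then show ?case by (cases i) auto
next
  case (Suc j)
  have B: "B \<ge> 0" using assms by linarith
  have "coeff ([:w, u:] ^ Suc j) i = w * coeff ([:w, u:] ^ j) i + (if i = 0 then 0 else u * coeff ([:w, u:] ^ j) (i - 1))"
    by (cases i) (simp_all add: mult.commute)
  also have "\<bar>\<dots>\<bar> \<le> B * (2 * B) ^ j + B * (2 * B) ^ j"
    using Suc[of i] Suc [of "i - 1"] assms B
    by (intro order_trans [OF abs_triangle_ineq] add_mono) (auto simp: abs_mult intro!: mult_mono)
  also have "\<dots> = (2 * B) ^ Suc j" by simp
  finally show ?case .
qed

text \<open>There are \<open>(N + 1)^2\<close> unknown coefficients and \<open>N * N + 2 * N\<close>
  vanishing conditions, one fewer. That the resulting series is not identically zero is exactly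
  functional transcendence.\<close>

lemma mahler_auxiliary_fps:
  assumes s: "\<bar>s\<bar> = 1"
  obtains A :: "nat \<Rightarrow> int poly" where "\<And>j. degree (A j) \<le> N"
    "(\<Sum>j\<le>N. fps_of_poly (map_poly real_of_int (A j)) * mahler_fps s ^ j) \<noteq> 0"
    "N * N + 2 * N \<le> subdegree (\<Sum>j\<le>N. fps_of_poly (map_poly real_of_int (A j)) * mahler_fps s ^ j)"
proof -
  define T where "T = N * N + 2 * N"
  define m where "m k ij = (fps_X ^ fst ij * mahler_fps s ^ snd ij :: int fps) $ k" for k and ij :: "nat \<times> nat"
  define I where "I = {..N} \<times> {..N}"
  define H where "H = 1 + (\<Sum>k<T. \<Sum>ij\<in>I. nat \<bar>m k ij\<bar>)"
  have H: "\<bar>m k ij\<bar> \<le> int H" if "k < T" "ij \<in> I" for k ij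
  proof -
    have "nat \<bar>m k ij\<bar> \<le> (\<Sum>ij\<in>I. nat \<bar>m k ij\<bar>)"
      using that by (intro member_le_sum) (auto simp: I_def)
    also have "\<dots> \<le> (\<Sum>k<T. \<Sum>ij\<in>I. nat \<bar>m k ij\<bar>)"
      using that by (intro member_le_sum [where f = "\<lambda>k. \<Sum>ij\<in>I. nat \<bar>m k ij\<bar>"]) auto
    finally have "nat \<bar>m k ij\<bar> \<le> H" unfolding H_def by linarith
    then show ?thesis by linarith
  qed
  obtain x where x: "\<exists>ij\<in>I. x ij \<noteq> 0" "\<And>k. k \<in> {..<T} \<Longrightarrow> (\<Sum>ij\<in>I. m k ij * x ij) = 0"
  proof (rule siegel_lemma [of I "{..<T}" H m])
    show "card {..<T} < card I" by (simp add: I_def T_def)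
    show "1 \<le> H" by (simp add: H_def)
    show "\<bar>m k ij\<bar> \<le> int H" if "ij \<in> I" "k \<in> {..<T}" for ij k using H that by simp
  qed (simp add: I_def, simp, rule that)
  define A where "A j = (\<Sum>i\<le>N. monom (x (i, j)) i)" for j
  have coeff_A: "coeff (A j) i = (if i \<le> N then x (i, j) else 0)" for i j
    by (simp add: A_def coeff_sum)
  define E :: "real fps" where "E = (\<Sum>j\<le>N. fps_of_poly (map_poly real_of_int (A j)) * mahler_fps s ^ j)"
  define E0 :: "int fps" where "E0 = (\<Sum>j\<le>N. fps_of_poly (A j) * mahler_fps s ^ j)"
  have pow: "(mahler_fps s ^ j :: real fps) $ k = of_int ((mahler_fps s ^ j :: int fps) $ k)" for j k
    by (induction j arbitrary: k) (simp_all add: fps_mult_nth)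
  have E_nth: "E $ k = of_int (E0 $ k)" for k
    by (simp add: E_def E0_def fps_sum_nth fps_mult_nth pow coeff_map_poly)
  have E0_nth: "E0 $ k = (\<Sum>ij\<in>I. m k ij * x ij)" for k
  proof -
    have "fps_of_poly (A j) = (\<Sum>i\<le>N. fps_const (x (i, j)) * fps_X ^ i)" for j
      by (simp add: A_def fps_of_poly_sum fps_of_poly_monom)
    then have "E0 = (\<Sum>j\<le>N. \<Sum>i\<le>N. fps_const (x (i, j)) * (fps_X ^ i * mahler_fps s ^ j))"
      by (simp add: E0_def sum_distrib_right mult.assoc)
    then have "E0 $ k = (\<Sum>j\<le>N. \<Sum>i\<le>N. x (i, j) * m k (i, j))"
      by (simp add: fps_sum_nth m_def)
    also have "\<dots> = (\<Sum>i\<le>N. \<Sum>j\<le>N. m k (i, j) * x (i, j))"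
      by (subst sum.swap) (simp add: mult.commute)
    also have "\<dots> = (\<Sum>ij\<in>I. m k ij * x ij)"
      unfolding I_def by (subst sum.cartesian_product) (simp add: case_prod_unfold)
    finally show ?thesis .
  qed
  have "E \<noteq> 0"
  proof
    assume "E = 0"
    then have zero: "map_poly real_of_int (A j) = 0" if "j \<le> N" for j
      using mahler_fps_transcendental [OF s, of "\<lambda>j. map_poly real_of_int (A j)" N] that by (simp add: E_def)
    obtain i j where ij: "i \<le> N" "j \<le> N" "x (i, j) \<noteq> 0" using x(1) by (auto simp: I_def)
    have "real_of_int (coeff (A j) i) = 0"
      using zero [OF ij(2)] by (metis coeff_0 coeff_map_poly of_int_0)
    with ij show False by (simp add: coeff_A)
  qed
  moreover have "T \<le> subdegree E"
    using \<open>E \<noteq> 0\<close> by (intro subdegree_geI) (auto simp: E_nth E0_nth x(2))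
  moreover have "degree (A j) \<le> N" for j by (intro degree_le) (simp add: coeff_A)
  ultimately show ?thesis using that [of A] by (simp add: E_def T_def)
qed

text \<open>At \<open>x = 1 / B\<close> the auxiliary function times \<open>B ^ (2 * N)\<close> is
  an integer polynomial in \<theta> of degree at most \<open>N\<close> and height at most a constant
  times \<open>B ^ (2 * N)\<close>. Its value is of size at most \<open>B ^ -(N * N)\<close>, while
  Liouville's inequality bounds it below by a constant times
  \<open>B ^ -(2 * N * K)\<close>.\<close>

theorem mahler_fun_transcendental:
  fixes b :: int
  assumes s: "\<bar>s\<bar> = 1" and b: "b \<ge> 2"
  shows "\<not> algebraic (mahler_fun s (1 / b))"
proof
  define \<theta> where "\<theta> = mahler_fun s (1 / b)"
  assume "algebraic (mahler_fun s (1 / b))"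
  then obtain K :: nat where K:
    "\<And>N. \<exists>\<kappa>>0. \<forall>H\<ge>1. \<forall>A :: int poly. degree A \<le> N \<longrightarrow> (\<forall>i. \<bar>coeff A i\<bar> \<le> int H) \<longrightarrow>
       poly (map_poly real_of_int A) \<theta> \<noteq> 0 \<longrightarrow>
       \<kappa> / real H ^ K \<le> \<bar>poly (map_poly real_of_int A) \<theta>\<bar>"
    unfolding \<theta>_def by (rule algebraic_lower_bound) blast
  \<comment> \<open>Then \<open>N * N\<close> exceeds \<open>2 * N * K\<close> by \<open>N\<close>,
    so the inequality would bound \<open>B ^ N\<close> as \<open>B\<close> grows.\<close>
  define N where "N = 2 * K + 1"
  obtain \<kappa> where \<kappa>: "\<kappa> > 0" and liouville: "\<And>H A. H \<ge> 1 \<Longrightarrow> degree A \<le> N \<Longrightarrow> (\<And>i. \<bar>coeff A i\<bar> \<le> int H) \<Longrightarrow>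
       poly (map_poly real_of_int A) \<theta> \<noteq> 0 \<Longrightarrow> \<kappa> / real H ^ K \<le> \<bar>poly (map_poly real_of_int A) \<theta>\<bar>"
    using K [of N] by blast
  obtain A :: "nat \<Rightarrow> int poly" where deg: "\<And>j. degree (A j) \<le> N"
    and nz: "(\<Sum>j\<le>N. fps_of_poly (map_poly real_of_int (A j)) * mahler_fps s ^ j) \<noteq> 0"
    and sub: "N * N + 2 * N \<le> subdegree (\<Sum>j\<le>N. fps_of_poly (map_poly real_of_int (A j)) * mahler_fps s ^ j)"
    using mahler_auxiliary_fps [OF s, of N] by blast
  define E :: "real fps" where "E = (\<Sum>j\<le>N. fps_of_poly (map_poly real_of_int (A j)) * mahler_fps s ^ j)"
  define d where "d = subdegree E"
  have d: "N * N + 2 * N \<le> d" using sub by (simp add: d_def E_def)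
  have "fps_conv_radius E > 0"
    using eval_fps_poly_mahler(1) [OF s, of 0] unfolding E_def by (metis abs_zero zero_ereal_def zero_less_one)
  then obtain C0 where C0: "C0 > 0"
    "\<forall>\<^sub>F x in at_right 0. x ^ d / C0 \<le> \<bar>eval_fps E x\<bar> \<and> \<bar>eval_fps E x\<bar> \<le> C0 * x ^ d"
    using nz unfolding d_def by (rule_tac fps_order_bounds [of E]) (auto simp: E_def)
  define cA where "cA = 1 + (\<Sum>j\<le>N. \<Sum>i\<le>N. nat \<bar>coeff (A j) i\<bar>)"
  \<comment> \<open>It collects the \<open>N + 1\<close> summands of \<open>Z\<close>, the
    coefficients of the \<open>A j\<close>, and the powers of 2 from expanding the powers of
    \<open>u * X - w\<close>.\<close>
  define c where "c = (N + 1) * cA * 2 ^ N"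
  have "cA > 0" by (simp add: cA_def)
  then have c: "c \<ge> 1" by (simp add: c_def Suc_le_eq)
  have "filterlim (\<lambda>m. (1 / real_of_int b) ^ 2 ^ m) (at_right 0) sequentially"
    using b by (intro filterlim_power_2_power_at_right_0) auto
  from eventually_compose_filterlim [OF C0(2) this]
  have "\<forall>\<^sub>F m in sequentially. \<kappa> * real_of_int (b ^ 2 ^ m) \<le> C0 * real c ^ K"
  proof eventually_elim
    case (elim m)
    define B where "B = b ^ 2 ^ m"
    define x where "x = 1 / real_of_int B"
    have B: "B \<ge> 2" using b self_le_power [of b "2 ^ m"] by (simp add: B_def)
    have "(1 / real_of_int b) ^ 2 ^ m = x" by (simp add: x_def B_def power_one_over)
    with elim have ineq: "x ^ d / C0 \<le> \<bar>eval_fps E x\<bar>" "\<bar>eval_fps E x\<bar> \<le> C0 * x ^ d"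
      by simp_all
    have x: "0 < x" "x < 1" using B by (auto simp: x_def)
    obtain u w :: int where u: "\<bar>u\<bar> \<le> B" and w: "\<bar>w\<bar> \<le> B - 1" and uw: "B * mahler_fun s x = u * \<theta> - w"
      using mahler_fun_inverse_power [OF s b, of m] by (auto simp: B_def x_def \<theta>_def)
    define Ah where "Ah j = (\<Sum>i\<le>N. coeff (A j) i * B ^ (N - i))" for j
    have Ah: "B ^ N * poly (map_poly of_int (A j)) x = real_of_int (Ah j)" for j
      using int_poly_inverse_scaled [OF deg, of B] B by (simp add: Ah_def x_def)
    \<comment> \<open>\<open>B ^ N\<close> clears the denominators of the \<open>A j\<close> at
      \<open>x\<close>. Another \<open>B ^ N\<close> is split as \<open>B ^ j\<close>, which turns
      \<open>f(x) ^ j\<close> into a power of the linear form, and \<open>B ^ (N - j)\<close>, which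
      equalises the scaling.\<close>
    define Z where "Z = (\<Sum>j\<le>N. smult (Ah j * B ^ (N - j)) ([:-w, u:] ^ j))"
    have "poly (map_poly real_of_int Z) \<theta> = (\<Sum>j\<le>N. real_of_int (Ah j) * B ^ (N - j) * (u * \<theta> - w) ^ j)"
    proof -
      have "map_poly real_of_int Z = (\<Sum>j\<le>N. smult (of_int (Ah j * B ^ (N - j))) ([:- of_int w, of_int u:] ^ j))"
        unfolding Z_def by (simp add: map_poly_of_int_sum map_poly_smult map_poly_of_int_linear_power)
      then show ?thesis by (simp add: poly_sum algebra_simps)
    qed
    also have "\<dots> = (\<Sum>j\<le>N. B ^ (2 * N) * (poly (map_poly of_int (A j)) x * mahler_fun s x ^ j))"
    proof (rule sum.cong)
      fix j assume "j \<in> {..N}"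
      then have B2N: "real_of_int B ^ (2 * N) = B ^ N * B ^ (N - j) * B ^ j"
        by (simp add: mult_2 flip: power_add)
      then show "real_of_int (Ah j) * B ^ (N - j) * (u * \<theta> - w) ^ j
          = B ^ (2 * N) * (poly (map_poly of_int (A j)) x * mahler_fun s x ^ j)"
        unfolding uw [symmetric] Ah [symmetric] of_int_power B2N power_mult_distrib by (simp add: mult_ac)
    qed simp
    also have "\<dots> = B ^ (2 * N) * eval_fps E x"
      using eval_fps_poly_mahler(2) [OF s, of x "\<lambda>j. map_poly of_int (A j)" N] x
      by (simp add: E_def sum_distrib_left)
    finally have Z: "poly (map_poly real_of_int Z) \<theta> = B ^ (2 * N) * eval_fps E x" .
    have "0 < x ^ d / C0" using x C0 by simp
    \<comment> \<open>The two-sided estimate at 0 plays the part of a zero estimate: a nonzero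
      series does not vanish at small positive arguments.\<close>
    then have "eval_fps E x \<noteq> 0" using ineq by auto
    then have Z_nz: "poly (map_poly real_of_int Z) \<theta> \<noteq> 0" using Z B by simp
    have degZ: "degree Z \<le> N"
      unfolding Z_def
    proof (intro degree_sum_le)
      fix j assume "j \<in> {..N}"
      have "degree ([:- w, u:] ^ j) \<le> degree [:- w, u:] * j" by (rule degree_power_le)
      also have "\<dots> \<le> 1 * N" using \<open>j \<in> {..N}\<close> by (intro mult_mono) auto
      finally show "degree (smult (Ah j * B ^ (N - j)) ([:- w, u:] ^ j)) \<le> N"
        using degree_smult_le order_trans by fastforce
    qed simp
    have Ah_le: "\<bar>Ah j\<bar> \<le> int cA * B ^ N" if "j \<le> N" for j
    proof -
      have "\<bar>Ah j\<bar> \<le> (\<Sum>i\<le>N. \<bar>coeff (A j) i * B ^ (N - i)\<bar>)" unfolding Ah_def by (rule sum_abs)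
      also have "\<dots> \<le> (\<Sum>i\<le>N. \<bar>coeff (A j) i\<bar> * B ^ N)"
        unfolding abs_mult using B by (intro sum_mono mult_left_mono) (auto intro: power_increasing)
      also have "\<dots> = int (\<Sum>i\<le>N. nat \<bar>coeff (A j) i\<bar>) * B ^ N" by (simp add: sum_distrib_right)
      also have "\<dots> \<le> int cA * B ^ N"
      proof (intro mult_right_mono)
        have "(\<Sum>i\<le>N. nat \<bar>coeff (A j) i\<bar>) \<le> (\<Sum>j\<le>N. \<Sum>i\<le>N. nat \<bar>coeff (A j) i\<bar>)"
          using that by (intro member_le_sum [where f = "\<lambda>j. \<Sum>i\<le>N. nat \<bar>coeff (A j) i\<bar>"]) auto
        then have "(\<Sum>i\<le>N. nat \<bar>coeff (A j) i\<bar>) \<le> cA" unfolding cA_def by linarith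
        then show "int (\<Sum>i\<le>N. nat \<bar>coeff (A j) i\<bar>) \<le> int cA" by (simp only: of_nat_le_iff)
      qed (use B in simp)
      finally show ?thesis .
    qed
    define H where "H = c * nat B ^ (2 * N)"
    have H: "int H = int c * B ^ (2 * N)" using B by (simp add: H_def)
    have coeff_Z: "\<bar>coeff Z i\<bar> \<le> int H" for i
    proof -
      have "\<bar>coeff Z i\<bar> \<le> (\<Sum>j\<le>N. \<bar>Ah j * B ^ (N - j) * coeff ([:-w, u:] ^ j) i\<bar>)"
        unfolding Z_def by (simp add: coeff_sum)
      also have "\<dots> \<le> (\<Sum>j\<le>N. int cA * B ^ N * B ^ (N - j) * (2 * B) ^ j)"
        unfolding abs_mult using B u w
        by (intro sum_mono mult_mono Ah_le coeff_linear_power_le) auto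
      also have "\<dots> \<le> (\<Sum>j\<le>N. int cA * 2 ^ N * B ^ (2 * N))"
      proof (rule sum_mono)
        fix j assume j: "j \<in> {..N}"
        then have "B ^ (2 * N) = B ^ N * B ^ (N - j) * B ^ j"
          by (simp add: mult_2 flip: power_add)
        then have "int cA * B ^ N * B ^ (N - j) * (2 * B) ^ j = int cA * 2 ^ j * B ^ (2 * N)"
          by (simp add: power_mult_distrib mult_ac)
        also have "\<dots> \<le> int cA * 2 ^ N * B ^ (2 * N)"
          using j B by (intro mult_right_mono mult_left_mono power_increasing) auto
        finally show "int cA * B ^ N * B ^ (N - j) * (2 * B) ^ j \<le> int cA * 2 ^ N * B ^ (2 * N)" .
      qed
      also have "\<dots> = int H" unfolding H by (simp add: c_def algebra_simps)
      finally show ?thesis .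
    qed
    have "H \<ge> 1" using c B by (simp add: H_def)
    from liouville [OF this degZ coeff_Z Z_nz]
    have "\<kappa> / real H ^ K \<le> B ^ (2 * N) * \<bar>eval_fps E x\<bar>" using B by (simp add: Z abs_mult)
    also have "\<dots> \<le> B ^ (2 * N) * (C0 * x ^ (2 * N + N * N))"
    proof (intro mult_left_mono)
      have "C0 * x ^ d \<le> C0 * x ^ (2 * N + N * N)"
        using d x C0 by (intro mult_left_mono power_decreasing) auto
      then show "\<bar>eval_fps E x\<bar> \<le> C0 * x ^ (2 * N + N * N)" using ineq(2) by linarith
    qed (use B in simp)
    also have "\<dots> = C0 / B ^ (N * N)"
      using B by (simp add: x_def power_add power_one_over)
    finally have le: "\<kappa> * real_of_int B ^ (N * N) \<le> C0 * real H ^ K"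
      using \<open>H \<ge> 1\<close> B by (simp add: field_simps)
    have "real H = real c * real_of_int B ^ (2 * N)"
      using H by (metis of_int_mult of_int_of_nat_eq of_int_power)
    then have H_pow: "C0 * real H ^ K = C0 * real c ^ K * real_of_int B ^ (N * (2 * K))"
      by (simp add: power_mult_distrib power_mult [symmetric] mult_ac)
    have B_pow: "real_of_int B ^ (N * N) = real_of_int B ^ N * real_of_int B ^ (N * (2 * K))"
      by (simp add: N_def power_add [symmetric])
    have "\<kappa> * real_of_int B ^ N * real_of_int B ^ (N * (2 * K)) \<le> C0 * real c ^ K * real_of_int B ^ (N * (2 * K))"
      using le unfolding H_pow B_pow by (simp only: mult.assoc)
    then have "\<kappa> * real_of_int B ^ N \<le> C0 * real c ^ K"
      by (rule mult_right_le_imp_le) (use B in simp)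
    moreover have "\<kappa> * B \<le> \<kappa> * B ^ N"
      using \<kappa> B self_le_power [of "real_of_int B" N] by (intro mult_left_mono) (auto simp: N_def)
    ultimately show ?case by (simp add: B_def)
  qed
  moreover have "\<forall>\<^sub>F m in sequentially. \<kappa> * real_of_int (b ^ 2 ^ m) > C0 * real c ^ K"
  proof -
    obtain M where M: "real_of_int b ^ M > C0 * real c ^ K / \<kappa>"
      using real_arch_pow [of "real_of_int b"] b by auto
    have "\<kappa> * real_of_int (b ^ 2 ^ m) > C0 * real c ^ K" if "m \<ge> M" for m
    proof -
      have "M \<le> 2 ^ m" using that less_exp [of m] by linarith
      then have "real_of_int b ^ M \<le> real_of_int b ^ 2 ^ m" using b by (intro power_increasing) auto
      with M have "real_of_int b ^ 2 ^ m > C0 * real c ^ K / \<kappa>" by linarith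
      then show ?thesis using \<kappa> by (simp add: field_simps)
    qed
    then show ?thesis unfolding eventually_sequentially by blast
  qed
  ultimately have "\<forall>\<^sub>F m :: nat in sequentially. False" by eventually_elim simp
  then show False by simp
qed

theorem theorem7p1:
  fixes b :: int
  assumes "b \<ge> 2"
  shows "\<not> algebraic (L_fun (1 / real_of_int b)) \<and> \<not> algebraic (M_fun (1 / real_of_int b))
         \<and> irrationality_exponent (L_fun (1 / real_of_int b)) = 2
         \<and> irrationality_exponent (M_fun (1 / real_of_int b)) = 2"
proof -
  define x where "x = 1 / real_of_int b"
  have x: "0 < x" "x \<le> 1/2" using assms by (auto simp: x_def field_simps)
  have L: "L_fun x = mahler_fun 1 x" and M: "M_fun x = mahler_fun (- 1) x"
    using mahler_fun_suminf [of 1 x] mahler_fun_suminf [of "- 1" x] x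
    by (simp_all add: L_fun_def M_fun_def)
  have "\<not> algebraic (mahler_fun s x) \<and> irrationality_exponent (mahler_fun s x) = 2"
    if s: "\<bar>s\<bar> = 1" for s
  proof -
    have trans: "\<not> algebraic (mahler_fun s x)"
      unfolding x_def by (rule mahler_fun_transcendental [OF s assms])
    \<comment> \<open>Transcendence also supplies the irrationality that Dirichlet's lower bound for
      the exponent asks for.\<close>
    then have "mahler_fun s x \<notin> \<rat>" using rat_imp_algebraic by blast
    then have "irrationality_exponent (mahler_fun s x) \<ge> 2" by (rule irrationality_exponent_ge_2)
    moreover have "irrationality_exponent (mahler_fun s x) \<le> 2"
      unfolding x_def by (rule irrationality_exponent_mahler_fun_le_2 [OF s assms])
    ultimately show ?thesis using trans by (simp add: antisym)
  qed
  from this [of 1] this [of "- 1"] show ?thesis unfolding x_def [symmetric] L M by simp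
qed

end
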